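(* Let $G$ be a connected graph with $N_0$ vertices and $E_0$ edges, let $n\ge 3$ be odd, and let $\tau_n(G)$ be the $n$-polygon graph of $G$. The eigenvalues of the normalized Laplacian $\mathcal{L}_{\tau_n(G)}$ can be obtained in the following way. (i) $0$ is an eigenvalue of $\mathcal{L}_{\tau_n(G)}$ with multiplicity $1$. If $G$ is bipartite, $2$ is an eigenvalue of $\mathcal{L}_{\tau_n(G)}$ with multiplicity $1$. (ii) If $\mu$ is any root of $a_{\frac{n-1}{2}}(\mu)=0$, then $\mu$ is an eigenvalue of $\mathcal{L}_{\tau_n(G)}$ with multiplicity $N_0$. (iii) If $\mu$ is any root of $a_{\frac{n-1}{2}}(\mu)+a_{\frac{n-1}{2}-1}(\mu)=0$, then $\mu$ is an eigenvalue of $\mathcal{L}_{\tau_n(G)}$ with multiplicity $E_0-N_0+1$. (iv) If $G$ is non-bipartite and $\mu$ is any root of $a_{\frac{n-1}{2}}(\mu)-a_{\frac{n-1}{2}-1}(\mu)=0$, then $\mu$ is an eigenvalue of $\mathcal{L}_{\tau_n(G)}$ with multiplicity $E_0-N_0$. (v) If $G$ is bipartite and $\mu$ is any root of $a_{\frac{n-1}{2}}(\mu)-a_{\frac{n-1}{2}-1}(\mu)=0$, then $\mu$ is an eigenvalue of $\mathcal{L}_{\tau_n(G)}$ with multiplicity $E_0-N_0+1$. (vi) Let $\lambda$ be any eigenvalue of $\mathcal{L}_G$ with $\lambda\ne 0$ and $\lambda\neq 2$, and let $\mu_i(\lambda)$, $i=1,2,\dots,\frac{n+1}{2}$, be the roots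 of the equation (in $x$) $$1-\frac{a_{\frac{n-1}{2}+1}(x)-a_{\frac{n-1}{2}-1}(x)}{a_{\frac{n-1}{2}}(x)-a_{\frac{n-1}{2}-2}(x)}=\lambda .$$ Then each $\mu_i(\lambda)$, $i=1,\dots,\frac{n+1}{2}$, is an eigenvalue of $\mathcal{L}_{\tau_n(G)}$, and $m_{\mathcal{L}_G}(\lambda)=m_{\mathcal{L}_{\tau_n(G)}}(\mu_i(\lambda))$ for $i=1,\dots,\frac{n+1}{2}$.
   Context: Graphs are finite, simple and undirected; $G$ has at least one edge, so all degrees are positive. For a graph $H$ with adjacency matrix $A(H)$ and diagonal degree matrix $D(H)$, the normalized Laplacian is $\mathcal{L}_H=I-D(H)^{-1/2}A(H)D(H)^{-1/2}$, and $m_{\mathcal{L}_H}(\lambda)$ denotes the multiplicity of $\lambda$ as an eigenvalue of $\mathcal{L}_H$. "Eigenvalue with multiplicity $0$" means not an eigenvalue. For $n\ge 2$, the $n$-polygon graph $\tau_n(G)$ is obtained from $G$ by adding, for each edge $ij$ of $G$, a new path of length $n$ (with $n-1$ new internal vertices) joining $i$ and $j$, while keeping the edge $ij$; thus each edge of $G$ becomes an edge of an $(n+1)$-gon. The polynomials $a_k(\mu)$, $k\ge -1$, are defined by $a_{-1}(\mu)=0$, $a_0(\mu)=1$, and $a_k(\mu)=2(1-\mu)a_{k-1}(\mu)-a_{k-2}(\mu)$ for $k\ge 1$. *)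

theory Defs
  imports
    "HOL-Library.Countable_Set"
    "Graph_Theory.Digraph_Component"
    "Graph_Theory.Pair_Digraph"
    "Jordan_Normal_Form.Char_Poly"
begin

section \<open>Graphs\<close>

text \<open>
  A finite simple undirected graph is a \<^locale>\<open>pair_graph\<close>: a finite, loop-free, symmetric
  set of arcs. Each undirected edge is thus stored as two opposite arcs.
\<close>

definition uedges :: "'a pair_pre_digraph \<Rightarrow> 'a set set" where
  "uedges G = (\<lambda>(u, v). {u, v}) ` parcs G"

definition bipartite :: "'a pair_pre_digraph \<Rightarrow> bool" where
  "bipartite G \<longleftrightarrow> (\<exists>X Y. pverts G = X \<union> Y \<and> X \<inter> Y = {} \<and>
     (\<forall>(u, v) \<in> parcs G. (u \<in> X \<and> v \<in> Y) \<or> (u \<in> Y \<and> v \<in> X)))"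

section \<open>The polygon graph\<close>

text \<open>
  \<open>New e k\<close> is the \<open>k\<close>-th internal vertex (\<open>0 < k < n\<close>) of the path added for the edge \<open>e\<close>.
\<close>

datatype 'a polygon_vert = Old 'a | New "'a set" nat

text \<open>
  The path added for \<open>e\<close> has to be traversed in some direction; we fix one by choosing a first
  end. Up to isomorphism the resulting graph does not depend on this choice.
\<close>

definition first_end :: "'a set \<Rightarrow> 'a" where
  "first_end e = (SOME u. u \<in> e)"

definition second_end :: "'a set \<Rightarrow> 'a" where
  "second_end e = (SOME v. e = {first_end e, v})"

definition path_vert :: "nat \<Rightarrow> 'a set \<Rightarrow> nat \<Rightarrow> 'a polygon_vert" where
  "path_vert n e k =
     (if k = 0 then Old (first_end e) else if k = n then Old (second_end e) else New e k)"

definition path_arcs :: "nat \<Rightarrow> 'a pair_pre_digraph \<Rightarrow> 'a polygon_vert rel" where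
  "path_arcs n G = {(path_vert n e k, path_vert n e (Suc k)) | e k. e \<in> uedges G \<and> k < n}"

definition polygon_graph :: "nat \<Rightarrow> 'a pair_pre_digraph \<Rightarrow> 'a polygon_vert pair_pre_digraph" where
  "polygon_graph n G =
     \<lparr> pverts = Old ` pverts G \<union> {New e k | e k. e \<in> uedges G \<and> 0 < k \<and> k < n},
       parcs = {(Old u, Old v) | u v. (u, v) \<in> parcs G} \<union> path_arcs n G \<union> (path_arcs n G)\<inverse> \<rparr>"

section \<open>The normalized Laplacian\<close>

text \<open>
  The matrices are indexed by \<open>0, \<dots>, N - 1\<close> through the enumeration
  \<^term>\<open>from_nat_into (pverts G)\<close> of the finite vertex set, a bijection from \<open>{..<N}\<close>. Another
  enumeration would give a matrix similar via a permutation matrix.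
\<close>

definition adjacency_matrix :: "'a pair_pre_digraph \<Rightarrow> real mat" where
  "adjacency_matrix G = (let N = card (pverts G); vert = from_nat_into (pverts G) in
     Matrix.mat N N (\<lambda>(i, j). if (vert i, vert j) \<in> parcs G then 1 else 0))"

definition degree_inv_sqrt_matrix :: "'a pair_pre_digraph \<Rightarrow> real mat" where
  "degree_inv_sqrt_matrix G =
     mat_diag (card (pverts G))
       (\<lambda>i. real (out_degree (with_proj G) (from_nat_into (pverts G) i)) powr (-1/2))"

definition norm_laplacian :: "'a pair_pre_digraph \<Rightarrow> real mat" where
  "norm_laplacian G = 1\<^sub>m (card (pverts G)) -
     degree_inv_sqrt_matrix G * adjacency_matrix G * degree_inv_sqrt_matrix G"

text \<open>
  Eigenvalues and their (algebraic) multiplicities are taken over the complex numbers, so that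
  statements about arbitrary roots of polynomials do not presuppose that these roots are real.
  The multiplicity is \<open>0\<close> exactly for the numbers that are not eigenvalues.
\<close>

definition is_eigenvalue :: "real mat \<Rightarrow> complex \<Rightarrow> bool" where
  "is_eigenvalue M z = eigenvalue (map_mat complex_of_real M) z"

definition eig_mult :: "real mat \<Rightarrow> complex \<Rightarrow> nat" where
  "eig_mult M z = Polynomial.order z (char_poly (map_mat complex_of_real M))"

section \<open>The polynomials \<open>a\<^sub>k\<close>\<close>

text \<open>Only indices \<open>k \<ge> -1\<close> are meaningful; below that the value \<open>0\<close> is a dummy.\<close>

function a_poly :: "int \<Rightarrow> complex poly" where
  "a_poly k = (if k \<le> -1 then 0 else if k = 0 then 1
     else [:2, -2:] * a_poly (k - 1) - a_poly (k - 2))"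
  by auto
termination by (relation "measure (\<lambda>k. nat (k + 1))") auto

declare a_poly.simps [simp del]

text \<open>
  The solutions \<open>x\<close> of
  \<open>1 - (a\<^bsub>k+1\<^esub>(x) - a\<^bsub>k-1\<^esub>(x)) / (a\<^sub>k(x) - a\<^bsub>k-2\<^esub>(x)) = \<lambda>\<close>.
  Division by zero yields \<open>0\<close> in HOL, so the denominator must be required to be nonzero; otherwise
  its zeros would count as solutions for \<open>\<lambda> = 1\<close>.
\<close>

definition eq_roots :: "int \<Rightarrow> complex \<Rightarrow> complex set" where
  "eq_roots k l = {x. poly (a_poly k) x - poly (a_poly (k - 2)) x \<noteq> 0 \<and>
     1 - (poly (a_poly (k + 1)) x - poly (a_poly (k - 1)) x) /
         (poly (a_poly k) x - poly (a_poly (k - 2)) x) = l}"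

end

theory Submission
  imports Defs
    "Jordan_Normal_Form.Jordan_Normal_Form_Uniqueness"
    "Jordan_Normal_Form.Jordan_Normal_Form_Existence"
begin

text \<open>
  Write \<open>x = 1 - z\<close>. After rescaling by square roots of degrees, an eigenvector of the normalized
  Laplacian for \<open>z\<close> is a function \<open>f\<close> on the vertices whose sum over the neighbours of each vertex
  \<open>v\<close> is \<open>x deg(v) f(v)\<close>; accordingly its characteristic polynomial is, up to a nonzero constant,
  the determinant of the pencil \<open>x D - A\<close> of the degree matrix and the adjacency matrix.

  Along an attached path the eigenvalue equation is the recurrence
  \<open>f\<^sub>j\<^sub>-\<^sub>1 + f\<^sub>j\<^sub>+\<^sub>1 = 2 x f\<^sub>j\<close>. Its solutions are combinations of the Chebyshev values
  \<open>u\<^sub>j\<close> (\<open>sin_quot j x\<close> below), which for \<open>x = cos t\<close> are \<open>sin (j t) / sin t\<close>. Eliminating all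
  internal vertices is a Schur complement. With \<open>n = 2 k + 1\<close>, \<open>a = u\<^sub>k\<^sub>+\<^sub>1\<close>, \<open>b = u\<^sub>k\<close> it gives
  (lemma \<open>det_pencil_polygon\<close>), for \<open>E\<close> edges and \<open>N\<close> vertices of \<open>G\<close>,
  \<open>det (x D' - A') = u\<^sub>n\<^sup>E (2 a / u\<^sub>n)\<^sup>N det ((x a - b) D - (a - x b) A)\<close>, where the primed
  matrices belong to the polygon graph and \<open>u\<^sub>n = (a - b) (a + b)\<close>. If \<open>l\<close> runs through the spectrum
  of \<open>G\<close> with multiplicity, the last determinant is a constant times the product of the values of the
  polynomials \<open>q\<^sub>l = (x a - b) - (1 - l) (a - x b)\<close>. These formulas hold for all but
  finitely many \<open>z\<close>, hence as an identity of polynomials (lemma \<open>char_poly_polygon\<close>):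
  \<open>\<chi> ((a - b) (a + b))\<^sup>N = C ((a - b) (a + b))\<^sup>E a\<^sup>N \<Prod>\<^sub>l q\<^sub>l\<close>
  with \<open>\<chi>\<close> the characteristic polynomial of the polygon graph.

  Every multiplicity in the polygon graph is the order of a root of \<open>\<chi>\<close>, and so can be read off from this
  identity; there is no need to construct eigenvectors of the polygon graph or to treat separately the
  roots of \<open>u\<^sub>n\<close>, where the elimination breaks down. What is needed about the factors is the
  following.

  \<^item> The equation of the theorem for \<open>l\<close> is \<open>q\<^sub>l = 0\<close>. For real \<open>l\<close> between \<open>0\<close> and \<open>2\<close> the
    signs of \<open>q\<^sub>l\<close> at the \<open>k\<close> zeros of \<open>a\<close> alternate, and there is one more root on each side of
    them; so \<open>q\<^sub>l\<close> has \<open>k + 1\<close> simple roots, none of them a root of \<open>a\<close>. The zeros of \<open>a\<close> are simple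
    (\<open>level_poly_simple_roots\<close>, \<open>level_poly_nonzero_at_a_poly_root\<close>, \<open>order_a_poly\<close>).

  \<^item> For different \<open>l\<close> the \<open>q\<^sub>l\<close> have no common root (\<open>level_poly_disjoint_roots\<close>).

  \<^item> \<open>q\<^sub>0 = - z (a + b)\<close> and \<open>q\<^sub>2 = (2 - z) (a - b)\<close>. Therefore \<open>a + b\<close> and \<open>a - b\<close> have simple
    roots too, and at such a root the factor \<open>q\<^sub>0\<close> or \<open>q\<^sub>2\<close> adds the multiplicity of \<open>0\<close> or \<open>2\<close> in
    the spectrum of \<open>G\<close> to the exponent \<open>E - N\<close>.

  \<^item> The spectrum of \<open>G\<close> is real and lies between \<open>0\<close> and \<open>2\<close>; since \<open>G\<close> is connected, \<open>0\<close> is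
    simple, and \<open>2\<close> is simple or absent according to whether \<open>G\<close> is bipartite
    (\<open>norm_laplacian_spectrum\<close>).
\<close>

section \<open>Determinants indexed by finite sets\<close>

text \<open>
  Matrices are indexed by numbers, vertices are not. Indexing a determinant by the vertex set itself
  lets the vertices be split into blocks without choosing an enumeration compatible with the split.
\<close>

definition det_on :: "'v set \<Rightarrow> ('v \<Rightarrow> 'v \<Rightarrow> 'a::comm_ring_1) \<Rightarrow> 'a" where
  "det_on V f = det (mat (card V) (card V)
     (\<lambda>(i, j). f (from_nat_into V i) (from_nat_into V j)))"

text \<open>
  Two enumerations differ by a permutation, which acts on the rows and on the columns; its sign
  enters twice and cancels.
\<close>

lemma det_on_enumeration:
  assumes h: "bij_betw h {..<N} V"
  shows "det_on V f = det (mat N N (\<lambda>(i, j). f (h i) (h j)))"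
proof -
  have fin: "finite V" and card: "card V = N"
    using bij_betw_finite[OF h] bij_betw_same_card[OF h] by auto
  define g where "g = from_nat_into V"
  have g: "bij_betw g {..<N} V"
    unfolding g_def card[symmetric] by (rule bij_betw_from_nat_into_finite[OF fin])
  define p where "p i = (if i < N then inv_into {..<N} h (g i) else i)" for i
  have hp: "h (p i) = g i" if "i < N" for i
  proof -
    have "g i \<in> h ` {..<N}" using that h g by (auto simp: bij_betw_def)
    then show ?thesis using that by (simp add: p_def f_inv_into_f)
  qed
  have p: "p permutes {0..<N}"
  proof (rule bij_imp_permutes)
    have "bij_betw (inv_into {..<N} h \<circ> g) {..<N} {..<N}"
      using g bij_betw_inv_into[OF h] by (rule bij_betw_trans)
    then show "bij_betw p {0..<N} {0..<N}"
      unfolding atLeast0LessThan by (rule bij_betw_cong[THEN iffD1, rotated]) (simp add: p_def)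
  qed (simp add: p_def)
  have plt: "p i < N" if "i < N" for i using permutes_in_image[OF p, of i] that by simp
  define A where "A = mat N N (\<lambda>(i, j). f (h i) (h j))"
  define B where "B = mat N N (\<lambda>(i, j). A $$ (p i, j))"
  have A: "A \<in> carrier_mat N N" and B: "B \<in> carrier_mat N N" by (auto simp: A_def B_def)
  have "det_on V f = det (mat N N (\<lambda>(i, j). f (g i) (g j)))"
    by (simp add: det_on_def card g_def)
  also have "mat N N (\<lambda>(i, j). f (g i) (g j))
      = transpose_mat (mat N N (\<lambda>(i, j). transpose_mat B $$ (p i, j)))"
    by (rule eq_matI) (auto simp: A_def B_def plt hp)
  also have "det \<dots> = signof p * det (transpose_mat B)"
    by (subst det_transpose[of _ N]) (use B p in \<open>auto intro: det_permute_rows\<close>)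
  also have "\<dots> = signof p * (signof p * det A)"
    unfolding det_transpose[OF B] by (simp add: B_def det_permute_rows[OF A p])
  also have "\<dots> = det A" by (simp add: sign_def)
  finally show ?thesis by (simp add: A_def)
qed

lemma det_on_cong:
  assumes "\<And>u v. u \<in> V \<Longrightarrow> v \<in> V \<Longrightarrow> f u v = g u v"
  shows "det_on V f = det_on V g"
proof (cases "finite V")
  case True
  show ?thesis unfolding det_on_def
    by (rule arg_cong[of _ _ det], rule eq_matI)
      (use True bij_betwE[OF bij_betw_from_nat_into_finite[OF True]] in \<open>auto intro!: assms\<close>)
qed (simp add: det_on_def det_def)

lemma det_on_empty [simp]: "det_on {} f = 1"
  by (simp add: det_on_def det_def)

lemma det_on_singleton [simp]: "det_on {v} f = f v v"
proof -
  have "det_on {v} f = det (mat 1 1 (\<lambda>(i, j). f v v))"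
    by (rule det_on_enumeration) (auto simp: bij_betw_def inj_on_def)
  then show ?thesis by (simp add: det_def)
qed

lemma det_on_image:
  assumes fin: "finite V" and inj: "inj_on r V"
  shows "det_on (r ` V) f = det_on V (\<lambda>u v. f (r u) (r v))"
proof -
  define h where "h = from_nat_into V"
  have h: "bij_betw h {..<card V} V"
    unfolding h_def by (rule bij_betw_from_nat_into_finite[OF fin])
  from bij_betw_trans[OF this inj_on_imp_bij_betw[OF inj]]
  show ?thesis by (simp add: det_on_enumeration[OF h] det_on_enumeration)
qed

lemma det_on_scale:
  fixes f :: "'v \<Rightarrow> 'v \<Rightarrow> 'a::idom"
  assumes fin: "finite V"
  shows "det_on V (\<lambda>u v. s u * f u v * t v) = (\<Prod>v\<in>V. s v) * (\<Prod>v\<in>V. t v) * det_on V f"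
proof -
  define N h where "N = card V" and "h = from_nat_into V"
  have h: "bij_betw h {..<N} V"
    unfolding N_def h_def by (rule bij_betw_from_nat_into_finite[OF fin])
  have prod: "(\<Prod>v\<in>V. r v) = det (mat_diag N (\<lambda>i. r (h i)))" for r :: "'v \<Rightarrow> 'a"
  proof -
    have "det (mat_diag N (\<lambda>i. r (h i))) = prod_list (diag_mat (mat_diag N (\<lambda>i. r (h i))))"
      by (rule det_upper_triangular[of _ N]) (auto simp: mat_diag_def)
    also have "\<dots> = (\<Prod>i<N. r (h i))"
      by (simp add: prod_list_diag_prod mat_diag_def atLeast0LessThan)
    also have "\<dots> = (\<Prod>v\<in>V. r v)" by (rule prod.reindex_bij_betw[OF h])
    finally show ?thesis ..
  qed
  let ?F = "mat N N (\<lambda>(i, j). f (h i) (h j))"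
  have "mat N N (\<lambda>(i, j). s (h i) * f (h i) (h j) * t (h j))
      = mat_diag N (\<lambda>i. s (h i)) * ?F * mat_diag N (\<lambda>i. t (h i))"
    by (subst mat_diag_mult_left[of _ N N], simp, subst mat_diag_mult_right[of _ N N], simp)
      (rule eq_matI, auto)
  moreover have "det (mat_diag N (\<lambda>i. s (h i)) * ?F * mat_diag N (\<lambda>i. t (h i)))
      = det (mat_diag N (\<lambda>i. s (h i))) * det ?F * det (mat_diag N (\<lambda>i. t (h i)))"
    by (metis (no_types, lifting) det_mult mat_carrier mat_diag_dim mult_carrier_mat)
  ultimately show ?thesis
    unfolding det_on_enumeration[OF h] prod by simp
qed

lemma det_on_cmult:
  fixes f :: "'v \<Rightarrow> 'v \<Rightarrow> 'a::idom"
  assumes fin: "finite V"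
  shows "det_on V (\<lambda>u v. c * f u v) = c ^ card V * det_on V f"
  using det_on_scale[OF fin, of "\<lambda>_. c" f "\<lambda>_. 1"] by simp

text \<open>
  Eliminating the block \<open>W\<close>: multiplication from the right by the block matrix with identity diagonal
  blocks and lower left block \<open>- X\<close> has determinant \<open>1\<close> and clears the block of rows \<open>W\<close> and columns
  \<open>V\<close>. The hypothesis asks for a solution \<open>X\<close> of the linear system rather than for an inverse of the
  block \<open>W\<close>, because in the applications the solution is explicit.
\<close>

lemma det_on_Schur_complement:
  fixes f :: "'v \<Rightarrow> 'v \<Rightarrow> 'a::idom"
  assumes fin: "finite V" "finite W" and disj: "V \<inter> W = {}"
    and X: "\<And>w v. w \<in> W \<Longrightarrow> v \<in> V \<Longrightarrow> (\<Sum>w'\<in>W. f w w' * X w' v) = f w v"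
  shows "det_on (V \<union> W) f
    = det_on W f * det_on V (\<lambda>u v. f u v - (\<Sum>w\<in>W. f u w * X w v))"
proof -
  define N M where "N = card V" and "M = card W"
  define g h where "g = from_nat_into V" and "h = from_nat_into W"
  have g: "bij_betw g {..<N} V" and h: "bij_betw h {..<M} W"
    unfolding N_def M_def g_def h_def by (rule bij_betw_from_nat_into_finite[OF fin(1)],
        rule bij_betw_from_nat_into_finite[OF fin(2)])
  have gV: "g i \<in> V" if "i < N" for i using bij_betwE[OF g] that by auto
  have hW: "h i \<in> W" if "i < M" for i using bij_betwE[OF h] that by auto
  define r where "r i = (if i < N then g i else h (i - N))" for i
  have "bij_betw r ({..<N} \<union> {N..<N + M}) (V \<union> W)"
  proof (rule bij_betw_combine)
    show "bij_betw r {..<N} V"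
      using g by (rule bij_betw_cong[THEN iffD1, rotated]) (simp add: r_def)
    have "bij_betw (\<lambda>i. i - N) {N..<N + M} {..<M}"
      by (rule bij_betwI[of _ _ _ "\<lambda>i. i + N"]) auto
    from bij_betw_trans[OF this h] show "bij_betw r {N..<N + M} W"
      by (rule bij_betw_cong[THEN iffD1, rotated]) (simp add: r_def)
  qed (rule disj)
  also have "{..<N} \<union> {N..<N + M} = {..<N + M}" by auto
  finally have r: "bij_betw r {..<N + M} (V \<union> W)" .
  define A B C D where "A = mat N N (\<lambda>(i, j). f (g i) (g j))"
    and "B = mat N M (\<lambda>(i, j). f (g i) (h j))"
    and "C = mat M N (\<lambda>(i, j). f (h i) (g j))"
    and "D = mat M M (\<lambda>(i, j). f (h i) (h j))"
  define Y where "Y = mat M N (\<lambda>(i, j). - X (h i) (g j))"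
  define S where "S = mat N N (\<lambda>(i, j). f (g i) (g j) - (\<Sum>w\<in>W. f (g i) w * X w (g j)))"
  note defs = A_def B_def C_def D_def Y_def S_def
  have reindex: "(\<Sum>w\<in>W. p w) = (\<Sum>i\<in>{0..<M}. p (h i))" for p :: "'v \<Rightarrow> 'a"
    using sum.reindex_bij_betw[OF h, of p] by (simp add: atLeast0LessThan)
  have BY: "A + B * Y = S"
    by (rule eq_matI) (auto simp: defs scalar_prod_def reindex sum_negf)
  have DY: "C + D * Y = 0\<^sub>m M N"
    by (rule eq_matI)
      (auto simp: defs scalar_prod_def sum_negf X[OF hW gV, unfolded reindex])
  have "det_on (V \<union> W) f = det (mat (N + M) (N + M) (\<lambda>(i, j). f (r i) (r j)))"
    by (rule det_on_enumeration[OF r])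
  also have "mat (N + M) (N + M) (\<lambda>(i, j). f (r i) (r j)) = four_block_mat A B C D"
    by (rule eq_matI) (auto simp: defs r_def four_block_mat_def Let_def)
  also have "det \<dots> = det \<dots> * det (four_block_mat (1\<^sub>m N) (0\<^sub>m N M) Y (1\<^sub>m M))"
    by (subst det_four_block_mat_upper_right_zero) (auto simp: Y_def)
  also have "\<dots> = det (four_block_mat A B C D * four_block_mat (1\<^sub>m N) (0\<^sub>m N M) Y (1\<^sub>m M))"
    by (rule det_mult[symmetric, of _ "N + M"]) (auto simp: defs)
  also have "four_block_mat A B C D * four_block_mat (1\<^sub>m N) (0\<^sub>m N M) Y (1\<^sub>m M)
      = four_block_mat (A * 1\<^sub>m N + B * Y) (A * 0\<^sub>m N M + B * 1\<^sub>m M)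
          (C * 1\<^sub>m N + D * Y) (C * 0\<^sub>m N M + D * 1\<^sub>m M)"
    by (rule mult_four_block_mat) (auto simp: defs)
  also have "\<dots> = four_block_mat S B (0\<^sub>m M N) D"
  proof -
    have "A * 1\<^sub>m N = A" "A * 0\<^sub>m N M + B * 1\<^sub>m M = B" "C * 1\<^sub>m N = C"
      "C * 0\<^sub>m N M + D * 1\<^sub>m M = D"
      by (auto simp: defs)
    then show ?thesis by (simp add: BY DY)
  qed
  also have "det \<dots> = det S * det D"
    by (rule det_four_block_mat_lower_left_zero) (auto simp: defs)
  finally show ?thesis
    by (simp add: det_on_enumeration[OF g] det_on_enumeration[OF h] S_def D_def)
qed

text \<open>
  Split off one block at a time; as there are no entries between different blocks, the zero matrix
  solves the system of the Schur complement.
\<close>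

lemma det_on_UNION_diagonal:
  fixes f :: "'v \<Rightarrow> 'v \<Rightarrow> 'a::idom"
  assumes "finite I" and "\<And>i. i \<in> I \<Longrightarrow> finite (B i)" and "disjoint_family_on B I"
    and "\<And>i j u v. i \<in> I \<Longrightarrow> j \<in> I \<Longrightarrow> i \<noteq> j \<Longrightarrow> u \<in> B i \<Longrightarrow> v \<in> B j \<Longrightarrow> f u v = 0"
  shows "det_on (\<Union>i\<in>I. B i) f = (\<Prod>i\<in>I. det_on (B i) f)"
  using assms
proof (induction I)
  case (insert i I)
  have "det_on (B i \<union> (\<Union>j\<in>I. B j)) f = det_on (\<Union>j\<in>I. B j) f *
      det_on (B i) (\<lambda>u v. f u v - (\<Sum>w\<in>(\<Union>j\<in>I. B j). f u w * 0))"
  proof (rule det_on_Schur_complement)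
    show "finite (B i)" "finite (\<Union>j\<in>I. B j)" using insert.prems insert.hyps by auto
    show "B i \<inter> (\<Union>j\<in>I. B j) = {}"
      using insert.prems(2) insert.hyps by (fastforce simp: disjoint_family_on_def)
    fix w v assume "w \<in> (\<Union>j\<in>I. B j)" "v \<in> B i"
    then obtain j where "j \<in> I" "w \<in> B j" by auto
    then have "f w v = 0" using insert.hyps \<open>v \<in> B i\<close> by (intro insert.prems(3)[of j i]) auto
    then show "(\<Sum>w'\<in>(\<Union>j\<in>I. B j). f w w' * 0) = f w v" by simp
  qed
  moreover have "det_on (\<Union>j\<in>I. B j) f = (\<Prod>j\<in>I. det_on (B j) f)"
    proof (rule insert.IH)
    show "disjoint_family_on B I" using insert.prems(2) by (auto simp: disjoint_family_on_def)
    show "f u v = 0" if "j \<in> I" "j' \<in> I" "j \<noteq> j'" "u \<in> B j" "v \<in> B j'" for j j' u v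
      using that by (intro insert.prems(3)[of j j']) auto
  qed (use insert.prems in auto)
  ultimately show ?case using insert.hyps by simp
qed simp

section \<open>Chebyshev polynomials and path determinants\<close>

text \<open>
  At \<open>x = cos t\<close> this is \<open>sin (j t) / sin t\<close>, so \<open>sin_quot (Suc j)\<close> is the Chebyshev polynomial of the
  second kind of degree \<open>j\<close>. The index is shifted so that the sequence starts with the value \<open>0\<close>, like
  the polynomials \<open>a\<^sub>k\<close> at \<open>k = -1\<close>.
\<close>

fun sin_quot :: "nat \<Rightarrow> 'a::comm_ring_1 \<Rightarrow> 'a" where
  "sin_quot 0 x = 0"
| "sin_quot (Suc 0) x = 1"
| "sin_quot (Suc (Suc j)) x = 2 * x * sin_quot (Suc j) x - sin_quot j x"

lemma sin_quot_at_1: "sin_quot j 1 = of_nat j"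
  by (induction j "1 :: 'a" rule: sin_quot.induct) (simp_all add: algebra_simps)

text \<open>
  The quadratic form on the left is invariant under the recurrence. It is used to show that two
  expressions in consecutive terms do not vanish together.
\<close>

lemma sin_quot_Cassini:
  "(sin_quot (Suc j) x)\<^sup>2 - 2 * x * sin_quot (Suc j) x * sin_quot j x + (sin_quot j x)\<^sup>2 = 1"
proof (induction j)
  case (Suc j)
  then show ?case by (simp add: algebra_simps power2_eq_square)
qed simp

text \<open>
  The double-angle formulas. The first one makes \<open>u\<^sub>n\<close> split into two factors for odd \<open>n\<close>; it is proved
  together with the second one because the recurrence alternates between the two parities.
\<close>

lemma sin_quot_odd_even:
  "sin_quot (Suc (2 * j)) x = (sin_quot (Suc j) x)\<^sup>2 - (sin_quot j x)\<^sup>2 \<and>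
   sin_quot (2 * j + 2) x
     = 2 * sin_quot (Suc j) x * (x * sin_quot (Suc j) x - sin_quot j x)"
proof (induction j)
  case (Suc j)
  define a b where "a = sin_quot (Suc j) x" and "b = sin_quot j x"
  have odd: "sin_quot (Suc (2 * j)) x = a\<^sup>2 - b\<^sup>2"
    and even: "sin_quot (Suc (Suc (2 * j))) x = 2 * a * (x * a - b)"
    using Suc.IH by (simp_all add: a_def b_def del: sin_quot.simps(3))
  have step: "sin_quot (Suc (Suc j)) x = 2 * x * a - b"
    "sin_quot (Suc (2 * Suc j)) x
      = 2 * x * sin_quot (Suc (Suc (2 * j))) x - sin_quot (Suc (2 * j)) x"
    "sin_quot (2 * Suc j + 2) x
      = 2 * x * sin_quot (Suc (2 * Suc j)) x - sin_quot (Suc (Suc (2 * j))) x"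
    by (simp_all add: a_def b_def)
  show ?case
    unfolding step odd even a_def[symmetric]
    by (simp add: algebra_simps power2_eq_square)
qed simp

lemmas sin_quot_odd = sin_quot_odd_even[THEN conjunct1]
  and sin_quot_even = sin_quot_odd_even[THEN conjunct2]

text \<open>
  The pencil of a path of vertices of degree \<open>2\<close>: the matrix \<open>2 x I\<close> minus the adjacency matrix of the
  natural numbers with consecutive numbers joined.
\<close>

definition tridiag :: "'a::comm_ring_1 \<Rightarrow> nat \<Rightarrow> nat \<Rightarrow> 'a" where
  "tridiag x i j = (if i = j then 2 * x else if j = Suc i \<or> i = Suc j then - 1 else 0)"

text \<open>
  Positions outside \<open>J\<close> act as positions where \<open>g\<close> has the value \<open>0\<close>.
\<close>

lemma sum_tridiag:
  assumes J: "finite J" "0 \<notin> J" and j: "0 < j"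
  shows "(\<Sum>i\<in>J. tridiag x j i * g i)
    = (if j \<in> J then 2 * x * g j else 0) - (if Suc j \<in> J then g (Suc j) else 0)
      - (if j - 1 \<in> J then g (j - 1) else 0)"
proof -
  have "tridiag x j i * g i = (if i = j then 2 * x * g i else 0)
      - (if i = Suc j then g i else 0) - (if i = j - 1 then g i else 0)" if "i \<in> J" for i
    using that J(2) j by (auto simp: tridiag_def)
  then have "(\<Sum>i\<in>J. tridiag x j i * g i) = (\<Sum>i\<in>J. (if i = j then 2 * x * g i else 0)
      - (if i = Suc j then g i else 0) - (if i = j - 1 then g i else 0))"
    by (rule sum.cong[OF refl])
  then show ?thesis by (simp only: sum_subtractf sum.delta[OF J(1)])
qed

text \<open>
  Induction on \<open>m\<close> by a Schur complement: to eliminate all vertices but the last one, the system to be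
  solved is the recurrence with value \<open>0\<close> at position \<open>0\<close> and value \<open>-1\<close> at position \<open>Suc m\<close>, and
  \<open>sin_quot\<close>, suitably scaled, solves it.
\<close>

lemma det_tridiag:
  fixes x :: "'a::field"
  assumes "\<And>j. 0 < j \<Longrightarrow> j \<le> m \<Longrightarrow> sin_quot j x \<noteq> 0"
  shows "det_on {1..m} (tridiag x) = sin_quot (Suc m) x"
  using assms
proof (induction m)
  case (Suc m)
  have nz: "sin_quot (Suc m) x \<noteq> 0" using Suc.prems by auto
  let ?X = "\<lambda>w v. - sin_quot w x / sin_quot (Suc m) x"
  have row: "(\<Sum>i\<in>{1..m}. tridiag x w i * ?X i v) = tridiag x w (Suc m)"
    if w_in: "w \<in> {1..m}" for w and v :: nat
  proof -
    obtain i where w: "w = Suc i" using w_in by (cases w) simp_all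
    show ?thesis
      using w_in nz unfolding w
      by (subst sum_tridiag) (auto simp: tridiag_def field_simps not_le less_Suc_eq)
  qed
  have last: "(\<Sum>i\<in>{1..m}. tridiag x (Suc m) i * ?X i v) = sin_quot m x / sin_quot (Suc m) x"
    for v :: nat
    by (subst sum_tridiag) (auto simp: not_le)
  have diag: "tridiag x (Suc m) (Suc m) = 2 * x" by (simp add: tridiag_def)
  have "{1..Suc m} = {Suc m} \<union> {1..m}" by auto
  also have "det_on \<dots> (tridiag x) = det_on {1..m} (tridiag x) *
      det_on {Suc m} (\<lambda>u v. tridiag x u v - (\<Sum>w\<in>{1..m}. tridiag x u w * ?X w v))"
    by (rule det_on_Schur_complement) (simp_all only: singleton_iff row, auto)
  also have "\<dots> = sin_quot (Suc m) x * (2 * x - sin_quot m x / sin_quot (Suc m) x)"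
    using Suc by (simp only: det_on_singleton last diag) simp
  also have "\<dots> = sin_quot (Suc (Suc m)) x"
    using nz by (simp add: field_simps)
  finally show ?case .
qed simp

section \<open>Eliminating the internal vertices of the polygon graph\<close>

lemma out_degree_with_proj:
  "out_degree (with_proj H) v = card {w. (v, w) \<in> parcs H}"
proof -
  have "out_arcs (with_proj H) v = Pair v ` {w. (v, w) \<in> parcs H}"
    by (auto simp: out_arcs_def)
  then show ?thesis by (simp add: out_degree_def card_image inj_on_def)
qed

text \<open>
  The entries of \<open>s D - t A\<close> for the degree matrix \<open>D\<close> and the adjacency matrix \<open>A\<close>. Two parameters are
  needed since eliminating the paths changes the coefficient of \<open>A\<close> as well.
\<close>

definition pencil :: "'v pair_pre_digraph \<Rightarrow> 'a::comm_ring_1 \<Rightarrow> 'a \<Rightarrow> 'v \<Rightarrow> 'v \<Rightarrow> 'a" where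
  "pencil H s t u v = (if u = v then s * of_nat (out_degree (with_proj H) u) else 0)
     - (if (u, v) \<in> parcs H then t else 0)"

lemma pencil_cmult: "c * pencil H s t u v = pencil H (c * s) (c * t) u v"
  by (simp add: pencil_def right_diff_distrib mult.assoc)

context pair_graph
begin

lemma finite_uedges: "finite (uedges G)"
  unfolding uedges_def using pair_finite_arcs by simp

lemma uedge_ends:
  assumes "e \<in> uedges G"
  shows "e = {first_end e, second_end e}" and "first_end e \<noteq> second_end e"
    and "(first_end e, second_end e) \<in> parcs G"
proof -
  obtain u v where uv: "(u, v) \<in> parcs G" "e = {u, v}"
    using assms by (auto simp: uedges_def)
  then have "first_end e \<in> e" unfolding first_end_def by (intro someI[of "\<lambda>u. u \<in> e" u]) simp
  then have "\<exists>w. e = {first_end e, w}" using uv by auto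
  then show e: "e = {first_end e, second_end e}" unfolding second_end_def by (rule someI_ex)
  show "first_end e \<noteq> second_end e"
  proof
    assume "first_end e = second_end e"
    with e have "e = {first_end e}" by simp
    with uv have "u = v" by (metis insertCI singletonD)
    with uv no_loops' show False by blast
  qed
  then show "(first_end e, second_end e) \<in> parcs G"
    using e uv arcs_symmetric by (metis doubleton_eq_iff)
qed

lemma uedges_iff: "{u, v} \<in> uedges G \<longleftrightarrow> (u, v) \<in> parcs G"
  using arcs_symmetric by (force simp: uedges_def doubleton_eq_iff)

text \<open>
  The edges at \<open>u\<close> are in bijection with the neighbours of \<open>u\<close> since there are no parallel edges.
\<close>

lemma card_incident_uedges:
  "card {e \<in> uedges G. u \<in> e} = out_degree (with_proj G) u"
proof -
  have "{e \<in> uedges G. u \<in> e} = (\<lambda>v. {u, v}) ` {v. (u, v) \<in> parcs G}"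
    using arcs_symmetric by (auto simp: uedges_def)
  moreover have "inj_on (\<lambda>v. {u, v}) {v. (u, v) \<in> parcs G}"
    by (auto simp: inj_on_def doubleton_eq_iff)
  ultimately show ?thesis by (simp add: out_degree_with_proj card_image)
qed

lemma finite_neighbours: "finite {w. (u, w) \<in> parcs G}"
  by (rule finite_subset[OF _ pair_finite_verts]) (auto dest: in_arcsD2)

end

locale polygon = pair_graph G for G :: "'v pair_pre_digraph" +
  fixes n :: nat
  assumes n3: "3 \<le> n"
begin

abbreviation \<tau> where "\<tau> \<equiv> polygon_graph n G"

definition news :: "'v polygon_vert set" where
  "news = (\<Union>e\<in>uedges G. New e ` {1..n - 1})"

lemma pverts_polygon: "pverts \<tau> = Old ` pverts G \<union> news"
  unfolding polygon_graph_def news_def by (auto simp: image_iff)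

lemma finite_news: "finite news"
  using finite_uedges by (simp add: news_def)

lemma path_arcs_iff:
  "(p, q) \<in> path_arcs n G \<longleftrightarrow>
     (\<exists>e k. e \<in> uedges G \<and> k < n \<and> p = path_vert n e k \<and> q = path_vert n e (Suc k))"
  by (auto simp: path_arcs_def)

lemma parcs_polygon_iff:
  "(p, q) \<in> parcs \<tau> \<longleftrightarrow> (\<exists>u v. (u, v) \<in> parcs G \<and> p = Old u \<and> q = Old v) \<or>
     (p, q) \<in> path_arcs n G \<or> (q, p) \<in> path_arcs n G"
  unfolding polygon_graph_def by auto

lemma parcs_Old_Old: "(Old u, Old v) \<in> parcs \<tau> \<longleftrightarrow> (u, v) \<in> parcs G"
  unfolding parcs_polygon_iff path_arcs_iff using n3 by (auto simp: path_vert_def split: if_splits)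

lemma parcs_Old_New:
  "(Old u, New e j) \<in> parcs \<tau> \<longleftrightarrow>
     e \<in> uedges G \<and> (j = 1 \<and> u = first_end e \<or> j = n - 1 \<and> u = second_end e)" (is "?L \<longleftrightarrow> ?R")
proof
  show "?L \<Longrightarrow> ?R"
    unfolding parcs_polygon_iff path_arcs_iff using n3
    by (auto simp: path_vert_def split: if_splits)
  assume ?R
  then have "(Old u, New e j) \<in> path_arcs n G \<or> (New e j, Old u) \<in> path_arcs n G"
  proof (elim conjE disjE)
    assume *: "e \<in> uedges G" "j = 1" "u = first_end e"
    then have "(Old u, New e j) \<in> path_arcs n G"
      unfolding path_arcs_iff using n3
      by (intro exI[of _ e] exI[of _ 0]) (auto simp: path_vert_def)
    then show ?thesis ..
  next
    assume *: "e \<in> uedges G" "j = n - 1" "u = second_end e"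
    then have "(New e j, Old u) \<in> path_arcs n G"
      unfolding path_arcs_iff using n3
      by (intro exI[of _ e] exI[of _ j]) (auto simp: path_vert_def)
    then show ?thesis ..
  qed
  then show ?L by (auto simp: parcs_polygon_iff)
qed

lemma parcs_polygon_commute: "(p, q) \<in> parcs \<tau> \<longleftrightarrow> (q, p) \<in> parcs \<tau>"
  unfolding parcs_polygon_iff using arcs_symmetric by blast

lemma parcs_New_New:
  assumes "1 \<le> i" "i < n" "1 \<le> j" "j < n"
  shows "(New e i, New e' j) \<in> parcs \<tau> \<longleftrightarrow> e \<in> uedges G \<and> e = e' \<and> (j = Suc i \<or> i = Suc j)"
    (is "?L \<longleftrightarrow> ?R")
proof
  show "?L \<Longrightarrow> ?R"
    unfolding parcs_polygon_iff path_arcs_iff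
    by (auto simp: path_vert_def split: if_splits)
  assume ?R
  then have "(New e i, New e' j) \<in> path_arcs n G \<or> (New e' j, New e i) \<in> path_arcs n G"
    unfolding path_arcs_iff using assms
    by (elim conjE disjE; intro disjI1 disjI2 exI[of _ e] exI[of _ "min i j"] conjI)
      (auto simp: path_vert_def)
  then show ?L by (auto simp: parcs_polygon_iff)
qed

text \<open>
  The three parts are disjoint (the last two because \<open>n\<close> is at least \<open>3\<close>), and the paths at \<open>u\<close> contribute as
  many neighbours as the edges at \<open>u\<close>; this doubles the degree.
\<close>

lemma neighbours_Old:
  "{q. (Old u, q) \<in> parcs \<tau>} = Old ` {v. (u, v) \<in> parcs G}
     \<union> ((\<lambda>e. New e 1) ` {e \<in> uedges G. u = first_end e}
     \<union> (\<lambda>e. New e (n - 1)) ` {e \<in> uedges G. u = second_end e})"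
proof -
  have "(Old u, q) \<in> parcs \<tau> \<longleftrightarrow> q \<in> Old ` {v. (u, v) \<in> parcs G}
     \<union> ((\<lambda>e. New e 1) ` {e \<in> uedges G. u = first_end e}
     \<union> (\<lambda>e. New e (n - 1)) ` {e \<in> uedges G. u = second_end e})" for q
    by (cases q) (auto simp: parcs_Old_Old parcs_Old_New)
  then show ?thesis by blast
qed

lemma out_degree_Old: "out_degree (with_proj \<tau>) (Old u) = 2 * out_degree (with_proj G) u"
proof -
  let ?F = "{e \<in> uedges G. u = first_end e}" and ?S = "{e \<in> uedges G. u = second_end e}"
  have fin: "finite ?F" "finite ?S" using finite_uedges by auto
  have FS: "?F \<inter> ?S = {}" using uedge_ends(2) by auto
  have "{e \<in> uedges G. u \<in> e} = ?F \<union> ?S" using uedge_ends(1) by blast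
  then have deg: "card ?F + card ?S = out_degree (with_proj G) u"
    using card_incident_uedges[of u] card_Un_disjoint[OF fin FS] by simp
  have "card {q. (Old u, q) \<in> parcs \<tau>} = card (Old ` {v. (u, v) \<in> parcs G})
      + (card ((\<lambda>e. New e 1) ` ?F) + card ((\<lambda>e. New e (n - 1)) ` ?S))"
    unfolding neighbours_Old using fin finite_neighbours n3
    by (subst card_Un_disjoint, simp, simp, force, subst card_Un_disjoint) auto
  also have "\<dots> = out_degree (with_proj G) u + (card ?F + card ?S)"
    by (simp add: card_image inj_on_def out_degree_with_proj)
  finally show ?thesis by (simp add: out_degree_with_proj deg[unfolded out_degree_with_proj])
qed

lemma neighbours_New:
  assumes "e \<in> uedges G" "1 \<le> j" "j < n"
  shows "{q. (New e j, q) \<in> parcs \<tau>} = {path_vert n e (j - 1), path_vert n e (Suc j)}"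
proof -
  have "{q. (New e j, q) \<in> parcs \<tau>} \<subseteq> {path_vert n e (j - 1), path_vert n e (Suc j)}"
    unfolding parcs_polygon_iff path_arcs_iff using assms
    by (auto simp: path_vert_def split: if_splits)
  moreover have "(New e j, path_vert n e (Suc j)) \<in> path_arcs n G"
    unfolding path_arcs_iff using assms
    by (intro exI[of _ e] exI[of _ j]) (auto simp: path_vert_def)
  moreover have "(path_vert n e (j - 1), New e j) \<in> path_arcs n G"
    unfolding path_arcs_iff using assms
    by (intro exI[of _ e] exI[of _ "j - 1"]) (auto simp: path_vert_def)
  ultimately show ?thesis by (auto simp: parcs_polygon_iff)
qed

lemma out_degree_New:
  assumes "e \<in> uedges G" "1 \<le> j" "j < n"
  shows "out_degree (with_proj \<tau>) (New e j) = 2"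
proof -
  have "path_vert n e (j - 1) \<noteq> path_vert n e (Suc j)"
    using assms n3 uedge_ends(2) by (auto simp: path_vert_def)
  then show ?thesis by (simp add: out_degree_with_proj neighbours_New[OF assms])
qed

lemma pencil_New_New:
  assumes "e \<in> uedges G" "i \<in> {1..n - 1}" "j \<in> {1..n - 1}"
  shows "pencil \<tau> x 1 (New e i) (New e' j) = (if e' = e then tridiag x i j else 0)"
proof -
  have deg: "out_degree (with_proj \<tau>) (New e i) = 2" using assms n3 by (intro out_degree_New) auto
  have adj: "(New e i, New e' j) \<in> parcs \<tau> \<longleftrightarrow> e = e' \<and> (j = Suc i \<or> i = Suc j)"
    using assms n3 by (subst parcs_New_New) auto
  show ?thesis unfolding pencil_def deg adj tridiag_def by (auto simp: mult.commute)
qed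

lemma pencil_New_Old:
  assumes "e \<in> uedges G" 
  shows "pencil \<tau> x 1 (New e j) (Old u)
    = - (if j = 1 \<and> u = first_end e then 1 else 0) - (if j = n - 1 \<and> u = second_end e then 1 else 0)"
    and "pencil \<tau> x 1 (Old u) (New e j)
    = - (if j = 1 \<and> u = first_end e then 1 else 0) - (if j = n - 1 \<and> u = second_end e then 1 else 0)"
proof -
  have adj: "(Old u, New e j) \<in> parcs \<tau> \<longleftrightarrow> j = 1 \<and> u = first_end e \<or> j = n - 1 \<and> u = second_end e"
    using assms by (subst parcs_Old_New) simp
  have "1 \<noteq> n - 1" using n3 by simp
  then show "pencil \<tau> x 1 (Old u) (New e j)
    = - (if j = 1 \<and> u = first_end e then 1 else 0) - (if j = n - 1 \<and> u = second_end e then 1 else 0)"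
    unfolding pencil_def adj by auto
  then show "pencil \<tau> x 1 (New e j) (Old u)
    = - (if j = 1 \<and> u = first_end e then 1 else 0) - (if j = n - 1 \<and> u = second_end e then 1 else 0)"
    by (simp add: pencil_def parcs_polygon_commute[of "New e j"])
qed

lemma pencil_Old_Old:
  "pencil \<tau> x 1 (Old u) (Old v) = pencil G (2 * x) 1 u v"
  by (simp add: pencil_def parcs_Old_Old out_degree_Old)

lemma sum_news:
  "(\<Sum>w\<in>news. p w) = (\<Sum>e\<in>uedges G. \<Sum>j\<in>{1..n - 1}. p (New e j))"
proof -
  have "(\<Sum>w\<in>news. p w) = (\<Sum>e\<in>uedges G. sum p (New e ` {1..n - 1}))"
    unfolding news_def by (rule sum.UNION_disjoint) (auto simp: finite_uedges)
  then show ?thesis by (simp add: sum.reindex inj_on_def)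
qed

text \<open>
  Without the old vertices the paths fall apart, one for each edge, and each has the determinant
  \<open>u\<^sub>n\<close>.
\<close>

lemma det_news:
  fixes x :: "'a::field"
  assumes nz: "\<And>j. 0 < j \<Longrightarrow> j \<le> n \<Longrightarrow> sin_quot j x \<noteq> 0"
  shows "det_on news (pencil \<tau> x 1) = sin_quot n x ^ card (uedges G)"
proof -
  have "det_on (New e ` {1..n - 1}) (pencil \<tau> x 1) = sin_quot n x" if e: "e \<in> uedges G" for e
  proof -
    have "det_on (New e ` {1..n - 1}) (pencil \<tau> x 1) = det_on {1..n - 1} (tridiag x)"
      by (subst det_on_image) (auto simp: inj_on_def pencil_New_New[OF e] intro!: det_on_cong)
    also have "\<dots> = sin_quot (Suc (n - 1)) x" by (rule det_tridiag) (use nz in auto)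
    finally show ?thesis using n3 by simp
  qed
  moreover have "det_on news (pencil \<tau> x 1)
      = (\<Prod>e\<in>uedges G. det_on (New e ` {1..n - 1}) (pencil \<tau> x 1))"
    unfolding news_def
  proof (rule det_on_UNION_diagonal[OF finite_uedges])
    show "disjoint_family_on (\<lambda>e. New e ` {1..n - 1}) (uedges G)"
      by (auto simp: disjoint_family_on_def)
    show "pencil \<tau> x 1 u v = 0"
      if ee: "e \<in> uedges G" "e' \<in> uedges G" "e \<noteq> e'" and uv: "u \<in> New e ` {1..n - 1}" "v \<in> New e' ` {1..n - 1}"
      for e e' u v
    proof -
      obtain i j where "u = New e i" "v = New e' j" "i \<in> {1..n - 1}" "j \<in> {1..n - 1}"
        using uv by blast
      then show ?thesis using pencil_New_New[OF ee(1), of i j x e'] ee(3) by simp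
    qed
  qed auto
  ultimately show ?thesis by simp
qed

text \<open>
  The Schur complement of the internal vertices. The function \<open>h e j v\<close> of the proof is, up to the sign,
  the solution of the recurrence along the path of \<open>e\<close> whose value at each end is \<open>1\<close> if that end is
  \<open>v\<close> and \<open>0\<close> otherwise. Hence a path between \<open>u\<close> and \<open>v\<close> adds \<open>- 1 / u\<^sub>n\<close> to the entry of \<open>u\<close> and \<open>v\<close>
  and \<open>- u\<^sub>n\<^sub>-\<^sub>1 / u\<^sub>n\<close> to their two diagonal entries. The result is again a pencil of \<open>G\<close>, and for
  odd \<open>n\<close> its two coefficients \<open>2 x - u\<^sub>n\<^sub>-\<^sub>1 / u\<^sub>n\<close> and \<open>1 + 1 / u\<^sub>n\<close> have the common factor
  \<open>2 a / u\<^sub>n\<close>. The nonvanishing hypothesis serves \<open>det_tridiag\<close>, which eliminates the vertices of a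
  path one after the other.
\<close>

theorem det_pencil_polygon:
  fixes x :: "'a::field"
  assumes nz: "\<And>j. 0 < j \<Longrightarrow> j \<le> n \<Longrightarrow> sin_quot j x \<noteq> 0" and n: "n = Suc (2 * k)"
  defines "a \<equiv> sin_quot (Suc k) x" and "b \<equiv> sin_quot k x"
  shows "det_on (pverts \<tau>) (pencil \<tau> x 1) = sin_quot n x ^ card (uedges G)
    * ((2 * a / sin_quot n x) ^ card (pverts G)
    * det_on (pverts G) (pencil G (x * a - b) (a - x * b)))"
proof -
  define c where "c = sin_quot n x"
  have c0: "c \<noteq> 0" using nz[of n] n by (simp add: c_def)
  define h where "h e j v = - ((if v = first_end e then sin_quot (n - j) x else 0)
      + (if v = second_end e then sin_quot j x else 0)) / c" for e j and v :: 'v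
  have h_ends: "h e 0 v = - (if v = first_end e then 1 else 0)"
      "h e n v = - (if v = second_end e then 1 else 0)" for e v
    using c0 by (auto simp: h_def c_def)
  have harmonic: "2 * x * h e j v = h e (Suc j) v + h e (j - 1) v"
    if j_in: "j \<in> {1..n - 1}" for e j v
  proof -
    obtain i where j: "j = Suc i" using j_in by (cases j) auto
    have "Suc (Suc i) \<le> n" using j_in n3 j by auto
    then obtain m where m: "n = Suc (Suc (i + m))" using le_Suc_ex[of "Suc (Suc i)" n] by auto
    show ?thesis using c0 unfolding h_def j m by (auto simp: field_simps)
  qed
  define X where "X w v = (case w of New e j \<Rightarrow> h e j (case v of Old u \<Rightarrow> u)
      | Old u \<Rightarrow> 0)" for w v :: "'v polygon_vert"
  have X: "X (New e j) (Old v) = h e j v" for e j v by (simp add: X_def)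
  have row: "(\<Sum>w'\<in>news. pencil \<tau> x 1 w w' * X w' v) = pencil \<tau> x 1 w v"
    if wv: "w \<in> news" "v \<in> Old ` pverts G" for w v
  proof -
    obtain e j where e: "e \<in> uedges G" and j: "j \<in> {1..n - 1}" and w: "w = New e j"
      using wv(1) by (auto simp: news_def)
    obtain u where v: "v = Old u" using wv(2) by auto
    have "(\<Sum>w'\<in>news. pencil \<tau> x 1 w w' * X w' v)
        = (\<Sum>e'\<in>uedges G. if e' = e then \<Sum>i\<in>{1..n - 1}. tridiag x j i * h e i u else 0)"
      unfolding sum_news
    proof (rule sum.cong[OF refl])
      fix e' assume "e' \<in> uedges G"
      have "(\<Sum>i\<in>{1..n - 1}. pencil \<tau> x 1 w (New e' i) * X (New e' i) v)
          = (\<Sum>i\<in>{1..n - 1}. if e' = e then tridiag x j i * h e i u else 0)"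
        by (rule sum.cong[OF refl]) (simp add: w v X pencil_New_New[OF e j])
      then show "(\<Sum>i\<in>{1..n - 1}. pencil \<tau> x 1 w (New e' i) * X (New e' i) v)
          = (if e' = e then \<Sum>i\<in>{1..n - 1}. tridiag x j i * h e i u else 0)" by simp
    qed
    also have "\<dots> = (\<Sum>i\<in>{1..n - 1}. tridiag x j i * h e i u)"
      using e by (simp add: finite_uedges)
    also have "\<dots> = 2 * x * h e j u - (if Suc j \<in> {1..n - 1} then h e (Suc j) u else 0)
        - (if j - 1 \<in> {1..n - 1} then h e (j - 1) u else 0)"
      using j by (subst sum_tridiag) auto
    \<comment> \<open>the end points are not summed over, so their values survive as the entries towards old vertices\<close>
    also have "\<dots> = (if j = n - 1 then h e n u else 0) + (if j = 1 then h e 0 u else 0)"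
      unfolding harmonic[OF j] using j n3 by (cases "j = 1"; cases "j = n - 1") auto
    also have "\<dots> = pencil \<tau> x 1 w v"
      by (auto simp: w v pencil_New_Old[OF e] h_ends)
    finally show ?thesis .
  qed
  have compl: "pencil \<tau> x 1 (Old u) (Old v)
        - (\<Sum>w\<in>news. pencil \<tau> x 1 (Old u) w * X w (Old v))
      = 2 * a / c * pencil G (x * a - b) (a - x * b) u v" for u v
  proof -
    define p where "p = sin_quot (n - 1) x"
    have "(\<Sum>j\<in>{1..n - 1}. pencil \<tau> x 1 (Old u) (New e j) * X (New e j) (Old v))
        = (if u \<in> e then if u = v then p / c else 0 else 0)
          + (if u \<noteq> v then if e = {u, v} then 1 / c else 0 else 0)" if e: "e \<in> uedges G" for e
    proof -
      have "(\<Sum>j\<in>{1..n - 1}. pencil \<tau> x 1 (Old u) (New e j) * X (New e j) (Old v))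
          = (\<Sum>j\<in>{1..n - 1}. (if j = 1 then if u = first_end e then - h e j v else 0 else 0)
            + (if j = n - 1 then if u = second_end e then - h e j v else 0 else 0))"
        by (rule sum.cong) (auto simp: X pencil_New_Old[OF e])
      also have "\<dots> = (if u = first_end e then - h e 1 v else 0)
          + (if u = second_end e then - h e (n - 1) v else 0)"
      proof -
        have "1 \<in> {1..n - 1}" "n - 1 \<in> {1..n - 1}" using n3 by auto
        then show ?thesis by (simp add: sum.distrib)
      qed
      also have "\<dots> = (if u = v then if u \<in> {first_end e, second_end e} then p / c else 0 else 0)
          + (if u \<noteq> v then if {first_end e, second_end e} = {u, v} then 1 / c else 0 else 0)"
        using n3 uedge_ends(2)[OF e] by (auto simp: h_def p_def doubleton_eq_iff)
      finally show ?thesis unfolding uedge_ends(1)[OF e, symmetric] by auto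
    qed
    then have "(\<Sum>w\<in>news. pencil \<tau> x 1 (Old u) w * X w (Old v))
        = (\<Sum>e\<in>uedges G. if u \<in> e then if u = v then p / c else 0 else 0)
          + (\<Sum>e\<in>uedges G. if u \<noteq> v then if e = {u, v} then 1 / c else 0 else 0)"
      unfolding sum_news by (simp add: sum.distrib)
    also have "(\<Sum>e\<in>uedges G. if u \<in> e then if u = v then p / c else 0 else 0)
        = (if u = v then of_nat (out_degree (with_proj G) u) * (p / c) else 0)"
      by (simp add: sum.If_cases finite_uedges Int_def card_incident_uedges)
    also have "(\<Sum>e\<in>uedges G. if u \<noteq> v then if e = {u, v} then 1 / c else 0 else 0)
        = (if (u, v) \<in> parcs G then 1 / c else 0)"
      using no_loops'[of u v] by (cases "u = v") (auto simp: finite_uedges uedges_iff)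
    finally have sum: "(\<Sum>w\<in>news. pencil \<tau> x 1 (Old u) w * X w (Old v))
        = (if u = v then of_nat (out_degree (with_proj G) u) * (p / c) else 0)
          + (if (u, v) \<in> parcs G then 1 / c else 0)" .
    obtain i where i: "n = Suc i" using n by blast
    have cc: "c = a\<^sup>2 - b\<^sup>2" unfolding c_def n a_def b_def by (rule sin_quot_odd)
    have "2 * x * c - p = sin_quot (2 * k + 2) x" by (simp add: c_def p_def i n[unfolded i])
    also have "\<dots> = 2 * a * (x * a - b)" unfolding a_def b_def by (rule sin_quot_even)
    finally have diag: "2 * x - p / c = 2 * a / c * (x * a - b)" using c0 by (simp add: field_simps)
    have "c + 1 = 2 * a * (a - x * b)"
      using sin_quot_Cassini[of k x] unfolding cc a_def b_def
      by (simp add: algebra_simps power2_eq_square)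
    then have off: "1 + 1 / c = 2 * a / c * (a - x * b)" using c0 by (simp add: field_simps)
    have "pencil \<tau> x 1 (Old u) (Old v)
        - (\<Sum>w\<in>news. pencil \<tau> x 1 (Old u) w * X w (Old v))
        = pencil G (2 * x - p / c) (1 + 1 / c) u v"
      unfolding sum pencil_Old_Old by (auto simp: pencil_def algebra_simps)
    also have "\<dots> = 2 * a / c * pencil G (x * a - b) (a - x * b) u v"
      unfolding diag off by (simp only: pencil_cmult)
    finally show ?thesis .
  qed
  have "det_on (pverts \<tau>) (pencil \<tau> x 1) = det_on news (pencil \<tau> x 1)
      * det_on (Old ` pverts G) (\<lambda>u v. pencil \<tau> x 1 u v
          - (\<Sum>w\<in>news. pencil \<tau> x 1 u w * X w v))"
    unfolding pverts_polygon
    by (rule det_on_Schur_complement[OF _ _ _ row])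
      (auto simp: pair_finite_verts finite_news, auto simp: news_def)
  also have "det_on (Old ` pverts G) (\<lambda>u v. pencil \<tau> x 1 u v
          - (\<Sum>w\<in>news. pencil \<tau> x 1 u w * X w v))
      = det_on (pverts G) (\<lambda>u v. 2 * a / c * pencil G (x * a - b) (a - x * b) u v)"
    by (subst det_on_image) (auto simp: pair_finite_verts inj_on_def compl)
  also have "\<dots> = (2 * a / c) ^ card (pverts G) * det_on (pverts G) (pencil G (x * a - b) (a - x * b))"
    by (rule det_on_cmult[OF pair_finite_verts])
  also have "det_on news (pencil \<tau> x 1) = c ^ card (uedges G)"
    unfolding c_def by (rule det_news) (rule nz)
  finally show ?thesis unfolding c_def .
qed

end

section \<open>Roots of the polynomial equations\<close>

lemma poly_a_poly: "poly (a_poly (int j - 1)) z = sin_quot j (1 - z)"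
proof (induction j "1 - z" rule: sin_quot.induct)
  case 1
  then show ?case by (simp add: a_poly.simps)
next
  case 2
  then show ?case by (simp add: a_poly.simps)
next
  case (3 j)
  have rec: "a_poly (int (Suc (Suc j)) - 1)
      = [:2, -2:] * a_poly (int (Suc j) - 1) - a_poly (int j - 1)"
    by (subst a_poly.simps) (simp add: algebra_simps)
  show ?case unfolding rec poly_diff poly_mult 3 by (simp add: algebra_simps)
qed

lemma degree_a_poly: "degree (a_poly (int j)) \<le> j"
proof -
  have "degree (a_poly (int j)) \<le> j \<and> degree (a_poly (int j - 1)) \<le> j"
  proof (induction j)
    case 0
    then show ?case by (simp add: a_poly.simps)
  next
    case (Suc j)
    have rec: "a_poly (int (Suc j)) = [:2, -2:] * a_poly (int j) - a_poly (int j - 1)"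
      by (subst a_poly.simps) (simp add: algebra_simps)
    have "degree ([:2, -2:] * a_poly (int j)) \<le> 1 + degree (a_poly (int j))"
      by (rule order_trans[OF degree_mult_le]) simp
    then have "degree (a_poly (int (Suc j))) \<le> Suc j"
      unfolding rec using Suc.IH by (intro degree_diff_le) auto
    then show ?case using Suc.IH by simp
  qed
  then show ?thesis ..
qed

text \<open>
  With \<open>x = 1 - z\<close>, \<open>a = a\<^sub>k\<close> and \<open>b = a\<^sub>k\<^sub>-\<^sub>1\<close>, the numerator and the denominator of the fraction in the
  equation for \<open>l\<close> are \<open>2 (x a - b)\<close> and \<open>2 (a - x b)\<close>. This is the equation with the denominator
  cleared. It is also what an eigenvalue \<open>l\<close> of \<open>G\<close> contributes to the determinant of the pencil
  \<open>(x a - b) D - (a - x b) A\<close>.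
\<close>

definition level_poly :: "nat \<Rightarrow> complex \<Rightarrow> complex poly" where
  "level_poly k l = [:1, -1:] * a_poly (int k) - a_poly (int k - 1)
     - Polynomial.smult (1 - l) (a_poly (int k) - [:1, -1:] * a_poly (int k - 1))"

lemma poly_level_poly:
  "poly (level_poly k l) z
    = ((1 - z) * sin_quot (Suc k) (1 - z) - sin_quot k (1 - z))
      - (1 - l) * (sin_quot (Suc k) (1 - z) - (1 - z) * sin_quot k (1 - z))"
  using poly_a_poly[of "Suc k" z] poly_a_poly[of k z]
  by (simp add: level_poly_def algebra_simps)

lemma degree_level_poly:
  assumes "0 < k"
  shows "degree (level_poly k l) \<le> Suc k"
proof -
  have shift: "degree ([:1, -1:] * p) \<le> Suc d" if "degree p \<le> d" for p :: "complex poly" and d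
    using that degree_mult_le[of "[:1, -1:]" p] by simp
  obtain j where j: "k = Suc j" using assms gr0_implies_Suc by blast
  have B: "degree (a_poly (int k - 1)) \<le> k" using degree_a_poly[of j] by (simp add: j)
  note A = degree_a_poly[of k]
  show ?thesis unfolding level_poly_def
    using A B shift[OF A] shift[OF B]
    by (intro degree_diff_le order_trans[OF degree_smult_le]) auto
qed

lemma level_poly_0: "level_poly k 0 = [:0, -1:] * (a_poly (int k) + a_poly (int k - 1))"
  unfolding level_poly_def by (rule poly_ext) (simp add: algebra_simps)

lemma level_poly_2: "level_poly k 2 = [:2, -1:] * (a_poly (int k) - a_poly (int k - 1))"
  unfolding level_poly_def by (rule poly_ext) (simp add: algebra_simps)

text \<open>
  A common root would force \<open>a = x b\<close> and \<open>b = x a\<close>, contradicting the invariant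
  \<open>a\<^sup>2 - 2 x a b + b\<^sup>2 = 1\<close>.
\<close>

lemma level_poly_disjoint_roots:
  assumes "poly (level_poly k l) z = 0" "poly (level_poly k l') z = 0"
  shows "l = l'"
proof (rule ccontr)
  assume "l \<noteq> l'"
  define x a b where "x = 1 - z" and "a = sin_quot (Suc k) x" and "b = sin_quot k x"
  have Cassini: "a\<^sup>2 - 2 * x * a * b + b\<^sup>2 = 1"
    unfolding a_def b_def by (rule sin_quot_Cassini)
  have eqs: "x * a - b = (1 - l) * (a - x * b)" "x * a - b = (1 - l') * (a - x * b)"
    using assms by (simp_all add: poly_level_poly x_def a_def b_def)
  from eqs(1)[symmetric] eqs(2) have "(1 - l) * (a - x * b) = (1 - l') * (a - x * b)" by (rule trans)
  then have ab: "a = x * b" using not_sym[OF \<open>l \<noteq> l'\<close>] by auto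
  then have "b = x * a" using eqs by simp
  then have "a\<^sup>2 - 2 * x * a * b + b\<^sup>2 = a * a - a * a - b * b + b * b"
    using ab by (simp add: power2_eq_square mult.assoc)
  then show False using Cassini by simp
qed

lemma sin_quot_of_real: "sin_quot j (complex_of_real x) = complex_of_real (sin_quot j x)"
  by (induction j x rule: sin_quot.induct) simp_all

lemma sin_quot_cos: "sin_quot j (cos t) * sin t = sin (real j * t)"
proof (induction j "cos t" rule: sin_quot.induct)
  case (3 j)
  have "sin (real (Suc (Suc j)) * t) = 2 * cos t * sin (real (Suc j) * t) - sin (real j * t)"
    using sin_add[of "real (Suc j) * t" t] sin_diff[of "real (Suc j) * t" t]
    by (simp add: algebra_simps)
  then show ?case by (simp add: left_diff_distrib mult.assoc 3 flip: of_nat_Suc)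
qed simp_all

lemma sin_quot_diff_cos:
  "sin_quot (Suc j) (cos t) - cos t * sin_quot j (cos t) = cos (real j * t)"
proof (induction j "cos t" rule: sin_quot.induct)
  case (3 j)
  have "cos (real (Suc (Suc j)) * t) = 2 * cos t * cos (real (Suc j) * t) - cos (real j * t)"
    using cos_add[of "real (Suc j) * t" t] cos_diff[of "real (Suc j) * t" t]
    by (simp add: algebra_simps)
  also have "\<dots> = 2 * cos t * (sin_quot (Suc (Suc j)) (cos t) - cos t * sin_quot (Suc j) (cos t))
      - (sin_quot (Suc j) (cos t) - cos t * sin_quot j (cos t))"
    by (simp only: 3)
  also have "\<dots> = sin_quot (Suc (Suc (Suc j))) (cos t) - cos t * sin_quot (Suc (Suc j)) (cos t)"
    by (simp add: algebra_simps)
  finally show ?case by simp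
qed simp_all

text \<open>
  The two brackets of \<open>level_poly\<close> are the Chebyshev polynomials of the first kind of degree \<open>Suc k\<close> and
  \<open>k\<close>.
\<close>

lemma poly_level_poly_cos:
  "poly (level_poly k (complex_of_real r)) (complex_of_real (1 - cos t))
    = complex_of_real (cos (real (Suc k) * t) - (1 - r) * cos (real k * t))"
proof -
  have "cos t * sin_quot (Suc k) (cos t) - sin_quot k (cos t)
      = sin_quot (Suc (Suc k)) (cos t) - cos t * sin_quot (Suc k) (cos t)"
    by simp
  also have "\<dots> = cos (real (Suc k) * t)" by (rule sin_quot_diff_cos)
  finally have 1: "cos t * sin_quot (Suc k) (cos t) - sin_quot k (cos t) = cos (real (Suc k) * t)" .
  have "1 - complex_of_real (1 - cos t) = complex_of_real (cos t)" by simp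
  then have "poly (level_poly k (complex_of_real r)) (complex_of_real (1 - cos t))
      = complex_of_real ((cos t * sin_quot (Suc k) (cos t) - sin_quot k (cos t))
        - (1 - r) * (sin_quot (Suc k) (cos t) - cos t * sin_quot k (cos t)))"
    unfolding poly_level_poly by (simp only: sin_quot_of_real of_real_diff of_real_mult of_real_1)
  then show ?thesis by (simp only: 1 sin_quot_diff_cos)
qed

text \<open>
  A double root could be divided out once without losing any root, leaving too many roots for the
  degree.
\<close>

lemma simple_roots_if_degree_le_card:
  fixes p :: "'a::idom poly"
  assumes "p \<noteq> 0" and R: "\<And>z. z \<in> R \<Longrightarrow> poly p z = 0" and card: "degree p \<le> card R"
  shows "{z. poly p z = 0} = R" and "poly p z = 0 \<Longrightarrow> Polynomial.order z p = 1"
proof -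
  have fin: "finite {z. poly p z = 0}" by (rule poly_roots_finite[OF \<open>p \<noteq> 0\<close>])
  have sub: "R \<subseteq> {z. poly p z = 0}" using R by auto
  show eq: "{z. poly p z = 0} = R"
    using card_subset_eq[OF fin sub] card_mono[OF fin sub] card_poly_roots_bound[OF \<open>p \<noteq> 0\<close>] card
    by simp
  assume z: "poly p z = 0"
  then obtain s where s: "p = [:- z, 1:] * s" by (metis dvdE poly_eq_0_iff_dvd)
  have "s \<noteq> 0" using s \<open>p \<noteq> 0\<close> by auto
  then have "degree p = Suc (degree s)" unfolding s by (subst degree_mult_eq) auto
  have "poly s z \<noteq> 0"
  proof
    assume "poly s z = 0"
    then have "R \<subseteq> {z. poly s z = 0}" using s sub by auto
    then have "card R \<le> degree s"
      using card_mono[OF poly_roots_finite[OF \<open>s \<noteq> 0\<close>]] card_poly_roots_bound[OF \<open>s \<noteq> 0\<close>]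
      by (meson order_trans)
    then show False using card \<open>degree p = Suc (degree s)\<close> by simp
  qed
  then have "Polynomial.order z s = 0" by (simp add: order_0I)
  moreover have "Polynomial.order z [:- z, 1:] = 1" using order_power_n_n[of z 1] by simp
  moreover have "Polynomial.order z p = Polynomial.order z [:- z, 1:] + Polynomial.order z s"
    using order_mult[of "[:- z, 1:]" s z] \<open>p \<noteq> 0\<close> unfolding s by blast
  ultimately show "Polynomial.order z p = 1" by simp
qed

context
  fixes k :: nat
  assumes k: "0 < k"
begin

text \<open>
  The zeros of \<open>a\<^sub>k\<close> are \<open>1 - cos (node j)\<close> for \<open>1 \<le> j \<le> k\<close>; \<open>node 0 = 0\<close> and
  \<open>node (Suc k) = \<pi>\<close> are the ends of the interval on which the roots of \<open>level_poly\<close> are located.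
\<close>

definition node :: "nat \<Rightarrow> real" where
  "node j = real j * pi / real (Suc k)"

lemma node_mono: "i \<le> j \<Longrightarrow> node i \<le> node j" and node_strict_mono: "i < j \<Longrightarrow> node i < node j"
  by (auto simp: node_def divide_right_mono divide_strict_right_mono)

lemma node_bounds: "0 < j \<Longrightarrow> 0 < node j" "j \<le> k \<Longrightarrow> node j < pi"
  using node_strict_mono[of 0 j] node_strict_mono[of j "Suc k"] by (auto simp: node_def)

lemma a_poly_roots:
  "{z. poly (a_poly (int k)) z = 0} = (\<lambda>j. complex_of_real (1 - cos (node j))) ` {1..k}"
  and order_a_poly: "poly (a_poly (int k)) z = 0 \<Longrightarrow> Polynomial.order z (a_poly (int k)) = 1"
proof -
  let ?R = "(\<lambda>j. complex_of_real (1 - cos (node j))) ` {1..k}"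
  have eval: "poly (a_poly (int k)) z = sin_quot (Suc k) (1 - z)" for z
    using poly_a_poly[of "Suc k" z] by simp
  have "inj_on (\<lambda>j. complex_of_real (1 - cos (node j))) {1..k}"
  proof (rule linorder_inj_onI)
    fix i j assume ij: "i < j" "i \<in> {1..k}" "j \<in> {1..k}"
    then have "cos (node j) < cos (node i)"
      using node_strict_mono[of i j] node_bounds[of i] node_bounds[of j]
      by (intro cos_monotone_0_pi) auto
    then show "complex_of_real (1 - cos (node i)) \<noteq> complex_of_real (1 - cos (node j))"
      by (simp only: of_real_eq_iff)
  qed auto
  then have card: "card ?R = k" by (simp add: card_image)
  have root: "poly (a_poly (int k)) z = 0" if zR: "z \<in> ?R" for z
  proof -
    obtain j where j: "1 \<le> j" "j \<le> k" "z = complex_of_real (1 - cos (node j))" using zR by auto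
    have "sin (real (Suc k) * node j) = 0" by (simp add: node_def)
    then have "sin_quot (Suc k) (cos (node j)) * sin (node j) = 0" by (simp only: sin_quot_cos)
    moreover have "sin (node j) > 0" using node_bounds[of j] j by (intro sin_gt_zero) auto
    ultimately have "sin_quot (Suc k) (cos (node j)) = 0" by simp
    then show ?thesis using sin_quot_of_real[of "Suc k" "cos (node j)"] by (simp add: eval j del: sin_quot.simps)
  qed
  have "poly (a_poly (int k)) 0 \<noteq> 0" by (simp add: eval sin_quot_at_1 del: sin_quot.simps of_nat_Suc)
  then have nz: "a_poly (int k) \<noteq> 0" by auto
  have deg: "degree (a_poly (int k)) \<le> card ?R" unfolding card by (rule degree_a_poly)
  note * = simple_roots_if_degree_le_card[OF nz root deg]
  show "{z. poly (a_poly (int k)) z = 0} = ?R" by (rule *(1))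
  show "poly (a_poly (int k)) z = 0 \<Longrightarrow> Polynomial.order z (a_poly (int k)) = 1" by (rule *(2))
qed

context
  fixes r :: real
  assumes r: "0 \<le> r" "r \<le> 2"
begin

lemma level_poly_node_pos:
  assumes "1 \<le> j" "j \<le> k"
  shows "0 < 1 - (1 - r) * cos (node j)"
proof -
  have "\<bar>cos (node j)\<bar> < 1"
    using cos_monotone_0_pi[of 0 "node j"] cos_monotone_0_pi[of "node j" pi] node_bounds[of j] assms
    by auto
  moreover have "\<bar>1 - r\<bar> \<le> 1" using r by auto
  then have "\<bar>(1 - r) * cos (node j)\<bar> \<le> \<bar>cos (node j)\<bar>"
    unfolding abs_mult by (simp add: mult_left_le_one_le)
  ultimately show ?thesis by linarith
qed

definition level_cos :: "real \<Rightarrow> real" where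
  "level_cos t = cos (real (Suc k) * t) - (1 - r) * cos (real k * t)"

lemma level_cos_node: "level_cos (node j) = (- 1) ^ j * (1 - (1 - r) * cos (node j))"
proof -
  have 1: "real (Suc k) * node j = real j * pi" by (simp add: node_def)
  then have "real k * node j = real j * pi - node j" by (simp add: algebra_simps)
  then have "cos (real k * node j) = (- 1) ^ j * cos (node j)"
    by (simp add: cos_diff)
  then show ?thesis unfolding level_cos_def 1 by (simp add: algebra_simps)
qed

lemma level_poly_nonzero_at_a_poly_root:
  assumes "poly (a_poly (int k)) z = 0"
  shows "poly (level_poly k (complex_of_real r)) z \<noteq> 0"
proof -
  have "z \<in> (\<lambda>j. complex_of_real (1 - cos (node j))) ` {1..k}"
    using assms a_poly_roots by blast
  then obtain j where j: "1 \<le> j" "j \<le> k" "z = complex_of_real (1 - cos (node j))" by auto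
  then show ?thesis
    using level_poly_node_pos[of j] level_cos_node[of j]
    by (simp only: j(3) poly_level_poly_cos level_cos_def[symmetric] of_real_eq_0_iff) simp
qed

text \<open>
  At \<open>node j\<close> the function \<open>level_cos\<close> has the sign of \<open>(- 1) ^ j\<close> or vanishes, and it vanishes at most
  at the two extreme nodes. So each of the \<open>Suc k\<close> closed intervals between consecutive nodes contains
  a zero, and these zeros differ because the inner nodes are not among them. As the degree is at most
  \<open>Suc k\<close>, all roots are found and they are simple. The extreme nodes are needed
  for \<open>r = 0\<close> and \<open>r = 2\<close>, where \<open>0\<close> and \<open>2\<close>, respectively, are roots.
\<close>

lemma level_poly_simple_roots:
  shows "level_poly k (complex_of_real r) \<noteq> 0"
    and "card {z. poly (level_poly k (complex_of_real r)) z = 0} = Suc k"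
    and "poly (level_poly k (complex_of_real r)) z = 0
      \<Longrightarrow> Polynomial.order z (level_poly k (complex_of_real r)) = 1"
proof -
  let ?p = "level_poly k (complex_of_real r)"
  have node_nz: "level_cos (node j) \<noteq> 0" if "1 \<le> j" "j \<le> k" for j
    using level_poly_node_pos[OF that] by (simp add: level_cos_node)
  have ge0: "0 \<le> 1 - (1 - r) * cos (node j)" for j
  proof -
    have "\<bar>(1 - r) * cos (node j)\<bar> \<le> 1 * 1"
      unfolding abs_mult using r by (intro mult_mono) auto
    then show ?thesis by linarith
  qed
  have "\<exists>t. node j \<le> t \<and> t \<le> node (Suc j) \<and> level_cos t = 0" for j
  proof -
    have cont: "\<forall>x. node j \<le> x \<and> x \<le> node (Suc j) \<longrightarrow> isCont (\<lambda>t. (- 1) ^ j * level_cos t) x"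
      unfolding level_cos_def by (auto intro!: continuous_intros)
    have "(- 1) ^ j * level_cos (node (Suc j)) \<le> 0" "0 \<le> (- 1) ^ j * level_cos (node j)"
      using ge0[of "Suc j"] ge0[of j] by (simp_all add: level_cos_node flip: mult.assoc power_add mult_2)
    then have "\<exists>t. node j \<le> t \<and> t \<le> node (Suc j) \<and> (- 1) ^ j * level_cos t = 0"
      using node_mono[of j "Suc j"] cont by (intro IVT2) auto
    then show ?thesis by simp
  qed
  then obtain t where t: "\<And>j. node j \<le> t j" "\<And>j. t j \<le> node (Suc j)" "\<And>j. level_cos (t j) = 0"
    by metis
  have t_less: "t i < t j" if "i < j" "j \<le> k" for i j
  proof -
    have "t i \<noteq> node (Suc i)" using node_nz[of "Suc i"] t(3)[of i] that by auto
    then have "t i < node (Suc i)" using t(2)[of i] by simp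
    also have "\<dots> \<le> node j" using that by (intro node_mono) simp
    also have "\<dots> \<le> t j" by (rule t(1))
    finally show ?thesis .
  qed
  let ?R = "(\<lambda>j. complex_of_real (1 - cos (t j))) ` {..k}"
  have "inj_on (\<lambda>j. complex_of_real (1 - cos (t j))) {..k}"
  proof (rule linorder_inj_onI)
    fix i j assume ij: "i < j" "i \<in> {..k}" "j \<in> {..k}"
    have "0 \<le> node i" by (simp add: node_def)
    then have "0 \<le> t i" using t(1)[of i] by linarith
    moreover have "t j \<le> pi"
      using t(2)[of j] node_mono[of "Suc j" "Suc k"] ij by (simp add: node_def)
    ultimately have "cos (t j) < cos (t i)"
      using t_less[of i j] ij by (intro cos_monotone_0_pi) auto
    then show "complex_of_real (1 - cos (t i)) \<noteq> complex_of_real (1 - cos (t j))"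
      by (simp only: of_real_eq_iff)
  qed auto
  then have card: "card ?R = Suc k" by (simp add: card_image)
  have root: "poly ?p z = 0" if "z \<in> ?R" for z
    using that t(3) by (auto simp only: poly_level_poly_cos level_cos_def[symmetric] of_real_0)
  have "complex_of_real (1 - cos (node 1)) \<in> {z. poly (a_poly (int k)) z = 0}"
    unfolding a_poly_roots using k by force
  then show nz: "?p \<noteq> 0" using level_poly_nonzero_at_a_poly_root by fastforce
  have deg: "degree ?p \<le> card ?R" unfolding card by (rule degree_level_poly[OF k])
  note * = simple_roots_if_degree_le_card[OF nz root deg]
  show "card {z. poly ?p z = 0} = Suc k" using *(1) card by simp
  show "poly ?p z = 0 \<Longrightarrow> Polynomial.order z ?p = 1" by (rule *(2))
qed

end

end

section \<open>Simple eigenvalues of Hermitian matrices\<close>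

lemma mult_mat_vec_index:
  assumes "A \<in> carrier_mat n n" "v \<in> carrier_vec n" "i < n"
  shows "(A *\<^sub>v v) $ i = (\<Sum>j<n. A $$ (i, j) * v $ j)"
  using assms by (auto simp: scalar_prod_def atLeast0LessThan intro!: sum.cong)

text \<open>
  If \<open>B (B v) = 0\<close> then \<open>u = B v\<close> has norm \<open>0\<close>, as the inner product of \<open>u\<close> with itself equals that of
  \<open>v\<close> with \<open>B u\<close>.
\<close>

lemma mat_kernel_hermitian_square:
  fixes B :: "complex mat"
  assumes B: "B \<in> carrier_mat n n"
    and herm: "\<And>i j. i < n \<Longrightarrow> j < n \<Longrightarrow> B $$ (i, j) = cnj (B $$ (j, i))"
  shows "mat_kernel (B * B) = mat_kernel B"
proof
  show "mat_kernel B \<subseteq> mat_kernel (B * B)" by (rule mat_kernel_mult_subset[OF B B])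
  show "mat_kernel (B * B) \<subseteq> mat_kernel B"
  proof
    fix v assume v: "v \<in> mat_kernel (B * B)"
    have BB: "B * B \<in> carrier_mat n n" using B by simp
    note vc = mat_kernelD[OF BB v]
    define u where "u = B *\<^sub>v v"
    have u: "u \<in> carrier_vec n" using B vc(1) by (simp add: u_def)
    have Bu: "B *\<^sub>v u = 0\<^sub>v n" using vc B by (simp add: u_def)
    have expand: "c * u $ i = (\<Sum>j<n. v $ j * (c * B $$ (i, j)))" if "i < n" for c i
      using that by (simp add: u_def mult_mat_vec_index[OF B vc(1)] sum_distrib_left ac_simps)
    have "complex_of_real (\<Sum>i<n. (cmod (u $ i))\<^sup>2) = (\<Sum>i<n. cnj (u $ i) * u $ i)"
      by (simp only: of_real_sum complex_norm_square mult.commute)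
    also have "\<dots> = (\<Sum>i<n. \<Sum>j<n. v $ j * (cnj (u $ i) * B $$ (i, j)))"
      by (rule sum.cong[OF refl], rule expand) simp
    also have "\<dots> = (\<Sum>j<n. v $ j * cnj (\<Sum>i<n. B $$ (j, i) * u $ i))"
    proof (subst sum.swap, rule sum.cong[OF refl])
      fix j assume "j \<in> {..<n}"
      then have "B $$ (i, j) = cnj (B $$ (j, i))" if "i < n" for i
        using that herm by blast
      then show "(\<Sum>i<n. v $ j * (cnj (u $ i) * B $$ (i, j)))
          = v $ j * cnj (\<Sum>i<n. B $$ (j, i) * u $ i)"
        unfolding cnj_sum sum_distrib_left by (intro sum.cong) (simp_all add: mult.commute)
    qed
    also have "\<dots> = 0"
    proof (rule sum.neutral, rule ballI)
      fix j assume "j \<in> {..<n}"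
      then have "(\<Sum>i<n. B $$ (j, i) * u $ i) = 0"
        using mult_mat_vec_index[OF B u, of j] Bu by simp
      then show "v $ j * cnj (\<Sum>i<n. B $$ (j, i) * u $ i) = 0" by simp
    qed
    finally have "(\<Sum>i<n. (cmod (u $ i))\<^sup>2) = 0" by (simp only: of_real_eq_0_iff)
    then have "\<forall>i\<in>{..<n}. (cmod (u $ i))\<^sup>2 = 0" by (subst (asm) sum_nonneg_eq_0_iff) auto
    then have "u = 0\<^sub>v n" using u by (intro eq_vecI) auto
    then show "v \<in> mat_kernel B" using vc(1) B by (intro mat_kernelI) (auto simp: u_def)
  qed
qed

text \<open>
  For Hermitian matrices the algebraic multiplicity of a one-dimensional eigenspace is \<open>1\<close>: the
  dimension of the eigenspace is the number of Jordan blocks, so there is a single block, and since the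
  square of \<open>A - z I\<close> has no larger kernel, this block has size \<open>1\<close>.
\<close>

lemma order_char_poly_simple_eigenvalue:
  fixes A :: "complex mat"
  assumes A: "A \<in> carrier_mat n n"
    and herm: "\<And>i j. i < n \<Longrightarrow> j < n \<Longrightarrow> A $$ (i, j) = cnj (A $$ (j, i))" and z: "cnj z = z"
    and w: "eigenvector A w z" and uniq: "\<And>v. eigenvector A v z \<Longrightarrow> \<exists>c. v = c \<cdot>\<^sub>v w"
  shows "Polynomial.order z (char_poly A) = 1"
proof -
  define B where "B = char_matrix A z"
  have B: "B \<in> carrier_mat n n" using A by (simp add: B_def)
  have Bherm: "B $$ (i, j) = cnj (B $$ (j, i))" if "i < n" "j < n" for i j
    using herm[OF that] that A z by (auto simp: B_def char_matrix_def)
  have wn: "w \<in> carrier_vec n" "B *\<^sub>v w = 0\<^sub>v n"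
    using w unfolding B_def eigenvector_char_matrix[OF A] by auto
  interpret K: kernel n n B by unfold_locales (rule B)
  have wK: "w \<in> mat_kernel B" using B wn by (intro mat_kernelI)
  have "mat_kernel B \<subseteq> K.span {w}"
  proof
    fix v assume v: "v \<in> mat_kernel B"
    have "\<exists>c. v = c \<cdot>\<^sub>v w"
    proof (cases "v = 0\<^sub>v n")
      case True
      then have "v = 0 \<cdot>\<^sub>v w" using wn by auto
      then show ?thesis ..
    next
      case False
      then show ?thesis using mat_kernelD[OF B v]
        by (intro uniq) (auto simp: eigenvector_char_matrix[OF A] B_def)
    qed
    then obtain c where "v = c \<cdot>\<^sub>v w" ..
    moreover have "w \<in> K.span {w}" using K.Ker.in_own_span[of "{w}"] wK by auto
    ultimately show "v \<in> K.span {w}"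
      using submodule.smult_closed[OF K.Ker.span_is_submodule, of "{w}" c w] wK by auto
  qed
  then have "K.gen_set {w}" using K.Ker.span_is_subset2[of "{w}"] wK by auto
  then have "K.dim \<le> card {w}" using wK by (intro K.Ker.gen_ge_dim) auto
  then have "K.dim \<le> 1" by simp
  then have d1: "dim_gen_eigenspace A z 1 \<le> 1"
    using B by (simp add: dim_gen_eigenspace_def B_def[symmetric] kernel_dim_def)
  have "mat_kernel (B * B) = mat_kernel B"
    by (rule mat_kernel_hermitian_square[OF B]) (rule Bherm)
  then have "kernel_dim (B * B) = kernel_dim B"
    using B by (simp add: kernel_dim_def)
  then have d2: "dim_gen_eigenspace A z 2 = dim_gen_eigenspace A z 1"
    using B by (simp add: dim_gen_eigenspace_def B_def[symmetric] numeral_2_eq_2)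
  obtain as where "char_poly A = (\<Prod>a\<leftarrow>as. [:- a, 1:])" using char_poly_factorized[OF A] by blast
  then obtain n_as where jnf: "jordan_nf A n_as" using jordan_nf_exists[OF A] by blast
  define bs where "bs = map fst (filter (\<lambda>na. snd na = z) n_as)"
  have dim: "dim_gen_eigenspace A z d = (\<Sum>b\<leftarrow>bs. min d b)" for d
    unfolding dim_gen_eigenspace[OF jnf] bs_def
    by (simp add: case_prod_unfold)
  have pos: "0 \<notin> set bs" using jnf by (auto simp: jordan_nf_def bs_def image_iff)
  have "(\<Sum>b\<leftarrow>bs. min 1 b) = length bs"
    using pos by (induction bs) auto
  then have len: "length bs \<le> 1" using d1 dim[of 1] by simp
  have order_sum: "Polynomial.order z (char_poly A) = sum_list bs"
    unfolding bs_def by (rule jordan_nf_order[OF jnf])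
  moreover have "Polynomial.order z (char_poly A) \<noteq> 0"
  proof -
    have "poly (char_poly A) z = 0"
      using w eigenvalue_root_char_poly[OF A, of z] by (auto simp: eigenvalue_def)
    moreover have "char_poly A \<noteq> 0" using degree_monic_char_poly[OF A] by auto
    ultimately show ?thesis by (simp add: order_root)
  qed
  ultimately have "length bs = 1" using len by (cases bs) auto
  then obtain b where b: "bs = [b]" by (auto simp: length_Suc_conv)
  have "min 2 b = min 1 b" using d2 unfolding dim b by simp
  moreover have "b \<noteq> 0" using pos b by simp
  ultimately have "b = 1" by linarith
  with order_sum show ?thesis unfolding b by simp
qed

section \<open>The spectrum of the normalized Laplacian\<close>

definition inv_sqrt_degree :: "'v pair_pre_digraph \<Rightarrow> 'v \<Rightarrow> real" where
  "inv_sqrt_degree H v = real (out_degree (with_proj H) v) powr (-1/2)"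

locale finite_positive_degrees =
  fixes H :: "'v pair_pre_digraph"
  assumes finite_verts: "finite (pverts H)"
    and degree_pos: "v \<in> pverts H \<Longrightarrow> 0 < out_degree (with_proj H) v"
begin

abbreviation "N \<equiv> card (pverts H)"
abbreviation "vert \<equiv> from_nat_into (pverts H)"
abbreviation "deg v \<equiv> out_degree (with_proj H) v"
abbreviation "M \<equiv> map_mat complex_of_real (norm_laplacian H)"

lemma bij_vert: "bij_betw vert {..<N} (pverts H)"
  by (rule bij_betw_from_nat_into_finite[OF finite_verts])

lemma vert_in: "i < N \<Longrightarrow> vert i \<in> pverts H"
  using bij_betwE[OF bij_vert] by auto

lemma vert_eq_iff: "i < N \<Longrightarrow> j < N \<Longrightarrow> vert i = vert j \<longleftrightarrow> i = j"
  using bij_vert by (auto simp: bij_betw_def inj_on_def)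

lemma inv_sqrt_degree_pos: "v \<in> pverts H \<Longrightarrow> 0 < inv_sqrt_degree H v"
  using degree_pos by (simp add: inv_sqrt_degree_def)

lemma inv_sqrt_degree_square:
  "v \<in> pverts H \<Longrightarrow> inv_sqrt_degree H v * inv_sqrt_degree H v * real (deg v) = 1"
  using degree_pos[of v] by (simp add: inv_sqrt_degree_def powr_minus_divide flip: powr_add)

lemma norm_laplacian_carrier: "norm_laplacian H \<in> carrier_mat N N"
  unfolding norm_laplacian_def degree_inv_sqrt_matrix_def adjacency_matrix_def Let_def
  by (intro minus_carrier_mat mult_carrier_mat[of _ N N]) auto

lemma M_carrier: "M \<in> carrier_mat N N"
  using norm_laplacian_carrier by simp

lemma M_index:
  assumes "i < N" "j < N"
  shows "M $$ (i, j) = (if i = j then 1 else 0) - complex_of_real (inv_sqrt_degree H (vert i))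
    * (if (vert i, vert j) \<in> parcs H then 1 else 0) * complex_of_real (inv_sqrt_degree H (vert j))"
proof -
  have "degree_inv_sqrt_matrix H * adjacency_matrix H * degree_inv_sqrt_matrix H
      = mat N N (\<lambda>(i, j). inv_sqrt_degree H (vert i)
          * (if (vert i, vert j) \<in> parcs H then 1 else 0) * inv_sqrt_degree H (vert j))"
    unfolding degree_inv_sqrt_matrix_def adjacency_matrix_def Let_def
    by (subst mat_diag_mult_left[of _ N N], simp, subst mat_diag_mult_right[of _ N N], simp)
      (rule eq_matI, auto simp: inv_sqrt_degree_def)
  then show ?thesis using assms by (simp add: norm_laplacian_def)
qed

text \<open>
  Taking \<open>inv_sqrt_degree\<close> out of all rows and columns turns \<open>z I\<close> minus the normalized Laplacian into
  the pencil \<open>(1 - z) D - A\<close>, up to the sign.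
\<close>

lemma poly_char_poly_norm_laplacian:
  obtains c where "c \<noteq> 0" "\<And>z. poly (char_poly M) z = c * det_on (pverts H) (pencil H (1 - z) 1)"
proof
  define s where "s v = complex_of_real (inv_sqrt_degree H v)" for v
  have s: "s v \<noteq> 0" "s v * s v * of_nat (deg v) = 1" if "v \<in> pverts H" for v
  proof -
    show "s v \<noteq> 0" using inv_sqrt_degree_pos[OF that] by (simp add: s_def)
    have "s v * s v * of_nat (deg v)
        = complex_of_real (inv_sqrt_degree H v * inv_sqrt_degree H v * real (deg v))"
      by (simp add: s_def)
    then show "s v * s v * of_nat (deg v) = 1" by (simp only: inv_sqrt_degree_square[OF that] of_real_1)
  qed
  let ?c = "(\<Prod>v\<in>pverts H. - s v) * (\<Prod>v\<in>pverts H. s v)"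
  show "?c \<noteq> 0" using s finite_verts by auto
  fix z
  let ?f = "\<lambda>u v. - s u * pencil H (1 - z) 1 u v * s v"
  have "poly (char_poly M) z = det (- char_matrix M z)"
    by (rule char_poly_matrix[OF M_carrier])
  also have "- char_matrix M z = mat N N (\<lambda>(i, j). ?f (vert i) (vert j))"
  proof (rule eq_matI)
    fix i j assume "i < dim_row (mat N N (\<lambda>(i, j). ?f (vert i) (vert j)))"
      "j < dim_col (mat N N (\<lambda>(i, j). ?f (vert i) (vert j)))"
    then have ij: "i < N" "j < N" by auto
    have M: "dim_row M = N" "dim_col M = N" using M_carrier by auto
    have "(- char_matrix M z) $$ (i, j) = (if i = j then z else 0) - M $$ (i, j)"
      using ij M by (simp add: char_matrix_def)
    also have "\<dots> = (if i = j then z - 1 else 0)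
        + s (vert i) * (if (vert i, vert j) \<in> parcs H then 1 else 0) * s (vert j)"
      unfolding M_index[OF ij] by (simp add: s_def)
    also have "(if i = j then z - 1 else 0)
        = - s (vert i) * (if vert i = vert j then (1 - z) * of_nat (deg (vert i)) else 0) * s (vert j)"
    proof (cases "i = j")
      case True
      have "- s (vert i) * ((1 - z) * of_nat (deg (vert i))) * s (vert i)
          = - (s (vert i) * s (vert i) * of_nat (deg (vert i))) * (1 - z)"
        by (simp add: algebra_simps)
      also have "\<dots> = z - 1" by (simp add: s(2)[OF vert_in[OF ij(1)]])
      finally show ?thesis using True by simp
    qed (use ij in \<open>simp add: vert_eq_iff\<close>)
    finally show "(- char_matrix M z) $$ (i, j) = mat N N (\<lambda>(i, j). ?f (vert i) (vert j)) $$ (i, j)"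
      using ij by (simp add: pencil_def algebra_simps)
  qed (use char_matrix_closed[OF M_carrier, of z] in auto)
  also have "det \<dots> = det_on (pverts H) ?f"
    by (rule det_on_enumeration[OF bij_vert, symmetric])
  also have "\<dots> = ?c * det_on (pverts H) (pencil H (1 - z) 1)"
    by (rule det_on_scale[OF finite_verts])
  finally show "poly (char_poly M) z = ?c * det_on (pverts H) (pencil H (1 - z) 1)" .
qed

text \<open>
  Eigenfunctions of the random walk on the graph for the eigenvalue \<open>1 - l\<close>. They correspond to the
  eigenvectors of the normalized Laplacian for \<open>l\<close> by multiplication with \<open>inv_sqrt_degree\<close>, and make
  the combinatorics of an eigenvalue visible.
\<close>

definition walk_eigenfunction :: "complex \<Rightarrow> ('v \<Rightarrow> complex) \<Rightarrow> bool" where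
  "walk_eigenfunction l f \<longleftrightarrow> (\<forall>v\<in>pverts H.
     (\<Sum>u\<in>pverts H. if (v, u) \<in> parcs H then f u else 0) = (1 - l) * of_nat (deg v) * f v)"

lemma norm_laplacian_eigen_iff:
  assumes w: "w \<in> carrier_vec N"
    and f: "\<And>i. i < N \<Longrightarrow> f (vert i) = complex_of_real (inv_sqrt_degree H (vert i)) * w $ i"
  shows "M *\<^sub>v w = l \<cdot>\<^sub>v w \<longleftrightarrow> walk_eigenfunction l f"
proof -
  define s where "s v = complex_of_real (inv_sqrt_degree H v)" for v
  define S where "S v = (\<Sum>u\<in>pverts H. if (v, u) \<in> parcs H then f u else 0)" for v
  have row: "(M *\<^sub>v w) $ i = w $ i - s (vert i) * S (vert i)" if i: "i < N" for i
  proof -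
    have "(M *\<^sub>v w) $ i = (\<Sum>j<N. (if i = j then w $ j else 0)
        - s (vert i) * (if (vert i, vert j) \<in> parcs H then f (vert j) else 0))"
      unfolding mult_mat_vec_index[OF M_carrier w i]
      by (rule sum.cong) (auto simp: M_index[OF i] f s_def algebra_simps)
    also have "\<dots> = w $ i - s (vert i)
        * (\<Sum>j<N. if (vert i, vert j) \<in> parcs H then f (vert j) else 0)"
      using i by (simp add: sum_subtractf sum_distrib_left)
    also have "(\<Sum>j<N. if (vert i, vert j) \<in> parcs H then f (vert j) else 0) = S (vert i)"
      unfolding S_def by (rule sum.reindex_bij_betw[OF bij_vert])
    finally show ?thesis .
  qed
  have "M *\<^sub>v w = l \<cdot>\<^sub>v w \<longleftrightarrow> (\<forall>i<N. w $ i - s (vert i) * S (vert i) = l * w $ i)"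
    using w M_carrier row by (auto simp: vec_eq_iff)
  also have "\<dots> \<longleftrightarrow> (\<forall>i<N. S (vert i) = (1 - l) * of_nat (deg (vert i)) * f (vert i))"
  proof (intro all_cong)
    fix i assume i: "i < N"
    let ?v = "vert i"
    have "complex_of_real (inv_sqrt_degree H ?v * inv_sqrt_degree H ?v * real (deg ?v)) = 1"
      by (simp only: inv_sqrt_degree_square[OF vert_in[OF i]] of_real_1)
    then have s1: "s ?v * (s ?v * of_nat (deg ?v)) = 1" by (simp add: s_def mult.assoc)
    then have s0: "s ?v \<noteq> 0" by auto
    have "w $ i - s ?v * S ?v = l * w $ i \<longleftrightarrow> s ?v * S ?v = (1 - l) * w $ i"
      by (auto simp: algebra_simps)
    also have "\<dots> \<longleftrightarrow> s ?v * S ?v = s ?v * ((1 - l) * of_nat (deg ?v) * f ?v)"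
    proof -
      have "s ?v * ((1 - l) * of_nat (deg ?v) * f ?v)
          = s ?v * (s ?v * of_nat (deg ?v)) * ((1 - l) * w $ i)"
        unfolding f[OF i] s_def by (simp add: ac_simps)
      then show ?thesis by (simp only: s1 mult_1)
    qed
    also have "\<dots> \<longleftrightarrow> S ?v = (1 - l) * of_nat (deg ?v) * f ?v"
      using s0 by simp
    finally show "w $ i - s ?v * S ?v = l * w $ i \<longleftrightarrow> S ?v = (1 - l) * of_nat (deg ?v) * f ?v" .
  qed
  also have "\<dots> \<longleftrightarrow> walk_eigenfunction l f"
  proof -
    have "(\<forall>v\<in>pverts H. P v) \<longleftrightarrow> (\<forall>i<N. P (vert i))" for P
      using bij_vert vert_in by (metis bij_betw_iff_bijections lessThan_iff)
    then show ?thesis unfolding walk_eigenfunction_def S_def by simp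
  qed
  finally show ?thesis .
qed

end

lemma order_prod_linear_factors:
  "Polynomial.order z (\<Prod>a\<leftarrow>as. [:- a, 1:]) = count_list as (z :: 'a::idom)"
proof (induction as)
  case (Cons a as)
  have "(\<Prod>a\<leftarrow>as. [:- a, 1:]) \<noteq> 0" by (auto simp: prod_list_zero_iff)
  then have nz: "[:- a, 1:] * (\<Prod>a\<leftarrow>as. [:- a, 1:]) \<noteq> 0"
    by (metis no_zero_divisors one_neq_zero pCons_eq_0_iff)
  have lin: "Polynomial.order z [:- a, 1:] = (if a = z then 1 else 0)"
    using order_power_n_n[of z 1] by (auto intro: order_0I)
  show ?case unfolding list.map prod_list.Cons order_mult[OF nz] Cons.IH lin by simp
qed simp

locale connected_pair_graph = pair_graph G for G :: "'v pair_pre_digraph" +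
  assumes connected: "Digraph_Component.connected (with_proj G)" and has_arc: "parcs G \<noteq> {}"
begin

text \<open>
  A property that is passed on along arcs spreads from one vertex to the whole graph.
\<close>

lemma connected_induct:
  assumes "u \<in> pverts G" "v \<in> pverts G" "P u"
    and step: "\<And>a b. (a, b) \<in> parcs G \<Longrightarrow> P a \<Longrightarrow> P b"
  shows "P v"
proof -
  have "strongly_connected (with_proj G)"
    using pair_sym_arcs connected by (rule symmetric_connected_imp_strongly_connected)
  then have "u \<rightarrow>\<^sup>*\<^bsub>with_proj G\<^esub> v"
    using assms by (auto simp: strongly_connected_def)
  then show ?thesis
    by (induction rule: reachable_induct) (use assms in auto)
qed

end

sublocale connected_pair_graph \<subseteq> finite_positive_degrees G
proof
  show "finite (pverts G)" by (rule pair_finite_verts)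
  fix v assume v: "v \<in> pverts G"
  obtain a b where ab: "(a, b) \<in> parcs G" using has_arc by auto
  have "\<exists>w. (v, w) \<in> parcs G"
  proof (rule connected_induct[of a v "\<lambda>v. \<exists>w. (v, w) \<in> parcs G"])
    show "a \<in> pverts G" using ab by (rule in_arcsD1)
  qed (use v ab arcs_symmetric in auto)
  then show "0 < out_degree (with_proj G) v"
    using finite_neighbours[of v] by (auto simp: out_degree_with_proj card_gt_0_iff)
qed

context connected_pair_graph
begin

lemma sum_neighbours_const:
  fixes c :: "'b::comm_ring_1"
  shows "(\<Sum>u\<in>pverts G. if (v, u) \<in> parcs G then c else 0) = of_nat (deg v) * c"
proof -
  have "pverts G \<inter> {u. (v, u) \<in> parcs G} = {u. (v, u) \<in> parcs G}" by (auto dest: in_arcsD2)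
  then show ?thesis by (simp add: sum.If_cases finite_verts out_degree_with_proj)
qed

lemma sum_arcs:
  "(\<Sum>v\<in>pverts G. \<Sum>u\<in>pverts G. if (v, u) \<in> parcs G then p v u else 0)
    = (\<Sum>a\<in>parcs G. p (fst a) (snd a))"
proof -
  have "(\<Sum>v\<in>pverts G. \<Sum>u\<in>pverts G. if (v, u) \<in> parcs G then p v u else 0)
      = (\<Sum>a\<in>pverts G \<times> pverts G. if a \<in> parcs G then p (fst a) (snd a) else 0)"
    by (simp add: sum.cartesian_product case_prod_unfold)
  also have "\<dots> = (\<Sum>a\<in>parcs G. p (fst a) (snd a))"
    by (rule sum.mono_neutral_cong_right) (auto simp: finite_verts dest: in_arcsD1 in_arcsD2)
  finally show ?thesis .
qed

lemma sum_arcs_swap: "(\<Sum>a\<in>parcs G. p (snd a) (fst a)) = (\<Sum>a\<in>parcs G. p (fst a) (snd a))"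
  by (rule sum.reindex_bij_witness[of _ prod.swap prod.swap]) (auto intro: arcs_symmetric)

text \<open>
  With the sums over all arcs \<open>Q = \<Sum> |f u|\<^sup>2\<close> and \<open>S = \<Sum> cnj (f u) f v\<close>, the eigenvalue equation gives
  \<open>S = (1 - l) Q\<close>. Reversing the arcs shows that \<open>S\<close> is real, hence so is \<open>l\<close>, and the sums of
  \<open>|f u - f v|\<^sup>2\<close> and \<open>|f u + f v|\<^sup>2\<close> are \<open>2 l Q\<close> and \<open>2 (2 - l) Q\<close>. Both are nonnegative, and they
  vanish only if each summand does.
\<close>

lemma walk_eigenfunction_spectrum:
  assumes f: "walk_eigenfunction l f" and v0: "v0 \<in> pverts G" "f v0 \<noteq> 0"
  shows "l = complex_of_real (Re l)" and "0 \<le> Re l" and "Re l \<le> 2"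
    and "l = 0 \<Longrightarrow> (u, v) \<in> parcs G \<Longrightarrow> f v = f u"
    and "l = 2 \<Longrightarrow> (u, v) \<in> parcs G \<Longrightarrow> f v = - f u"
proof -
  define Q where "Q = (\<Sum>a\<in>parcs G. (cmod (f (fst a)))\<^sup>2)"
  define S where "S = (\<Sum>a\<in>parcs G. cnj (f (fst a)) * f (snd a))"
  obtain u0 where u0: "(v0, u0) \<in> parcs G"
    using degree_pos[OF v0(1)] finite_neighbours[of v0]
    by (auto simp: out_degree_with_proj card_gt_0_iff)
  have "0 < (cmod (f (fst (v0, u0))))\<^sup>2" using v0 by simp
  also have "\<dots> \<le> Q" unfolding Q_def
    by (rule member_le_sum[OF u0]) (auto simp: pair_finite_arcs)
  finally have Q: "0 < Q" .
  have "S = (\<Sum>v\<in>pverts G. cnj (f v) * (\<Sum>u\<in>pverts G. if (v, u) \<in> parcs G then f u else 0))"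
    unfolding S_def sum_arcs[symmetric, of "\<lambda>u v. cnj (f u) * f v"]
    by (simp add: sum_distrib_left if_distrib[of "(*) _"] cong: if_cong)
  also have "\<dots> = (\<Sum>v\<in>pverts G. cnj (f v) * ((1 - l) * of_nat (deg v) * f v))"
    using f by (intro sum.cong) (auto simp: walk_eigenfunction_def)
  also have "\<dots> = (1 - l) * (\<Sum>v\<in>pverts G. of_nat (deg v) * complex_of_real ((cmod (f v))\<^sup>2))"
    unfolding complex_norm_square by (simp add: sum_distrib_left ac_simps)
  also have "(\<Sum>v\<in>pverts G. of_nat (deg v) * complex_of_real ((cmod (f v))\<^sup>2)) = complex_of_real Q"
    unfolding sum_neighbours_const[symmetric]
      sum_arcs[of "\<lambda>v u. complex_of_real ((cmod (f v))\<^sup>2)"] Q_def by simp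
  finally have S: "S = (1 - l) * complex_of_real Q" .
  have "cnj S = (\<Sum>a\<in>parcs G. cnj (f (snd a)) * f (fst a))"
    by (simp add: S_def mult.commute)
  also have "\<dots> = S"
    unfolding S_def by (rule sum_arcs_swap[of "\<lambda>u v. cnj (f u) * f v"])
  finally have "Im S = 0" by (metis complex_cnj_cancel_iff complex_cnj_complex_of_real complex_is_Real_iff Reals_cnj_iff)
  then have Im: "Im l = 0" using Q by (simp add: S)
  then show l: "l = complex_of_real (Re l)" by (simp add: complex_eq_iff)
  have ReS: "Re S = (1 - Re l) * Q" by (simp add: S Im)
  have Q': "(\<Sum>a\<in>parcs G. (cmod (f (snd a)))\<^sup>2) = Q"
    unfolding Q_def by (rule sum_arcs_swap[of "\<lambda>u v. (cmod (f u))\<^sup>2"])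
  have sq: "(cmod (x - y))\<^sup>2 = (cmod x)\<^sup>2 + (cmod y)\<^sup>2 - 2 * Re (cnj x * y)"
    "(cmod (x + y))\<^sup>2 = (cmod x)\<^sup>2 + (cmod y)\<^sup>2 + 2 * Re (cnj x * y)" for x y
    unfolding cmod_power2 by (simp_all add: power2_eq_square algebra_simps)
  have minus: "(\<Sum>a\<in>parcs G. (cmod (f (fst a) - f (snd a)))\<^sup>2) = 2 * Re l * Q"
    unfolding sq sum.distrib sum_subtractf Q' Q_def[symmetric] sum_distrib_left[symmetric]
      Re_sum[symmetric] S_def[symmetric] ReS by (simp add: algebra_simps)
  have plus: "(\<Sum>a\<in>parcs G. (cmod (f (fst a) + f (snd a)))\<^sup>2) = 2 * (2 - Re l) * Q"
    unfolding sq sum.distrib Q' Q_def[symmetric] sum_distrib_left[symmetric]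
      Re_sum[symmetric] S_def[symmetric] ReS by (simp add: algebra_simps)
  have "0 \<le> 2 * Re l * Q" unfolding minus[symmetric] by (rule sum_nonneg) simp
  then show "0 \<le> Re l" using Q by (simp add: zero_le_mult_iff)
  have "0 \<le> 2 * (2 - Re l) * Q" unfolding plus[symmetric] by (rule sum_nonneg) simp
  then show "Re l \<le> 2" using Q by (simp add: zero_le_mult_iff)
  show "f v = f u" if "l = 0" and uv: "(u, v) \<in> parcs G"
  proof -
    have "(\<Sum>a\<in>parcs G. (cmod (f (fst a) - f (snd a)))\<^sup>2) = 0" using minus \<open>l = 0\<close> by simp
    then have "\<forall>a\<in>parcs G. (cmod (f (fst a) - f (snd a)))\<^sup>2 = 0"
      by (subst (asm) sum_nonneg_eq_0_iff) (auto simp: pair_finite_arcs)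
    then show ?thesis using uv by fastforce
  qed
  show "f v = - f u" if "l = 2" and uv: "(u, v) \<in> parcs G"
  proof -
    have "(\<Sum>a\<in>parcs G. (cmod (f (fst a) + f (snd a)))\<^sup>2) = 0" using plus \<open>l = 2\<close> by simp
    then have "\<forall>a\<in>parcs G. (cmod (f (fst a) + f (snd a)))\<^sup>2 = 0"
      by (subst (asm) sum_nonneg_eq_0_iff) (auto simp: pair_finite_arcs)
    then have "f u + f v = 0" using uv by fastforce
    then show ?thesis by (simp add: eq_neg_iff_add_eq_0 add.commute)
  qed
qed

lemma eigenvector_imp_walk_eigenfunction:
  assumes "eigenvector M w l"
  obtains f v0 where "\<And>i. i < N \<Longrightarrow> f (vert i) = complex_of_real (inv_sqrt_degree G (vert i)) * w $ i"
    and "walk_eigenfunction l f" and "v0 \<in> pverts G" and "f v0 \<noteq> 0"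
proof
  have w: "w \<in> carrier_vec N" "w \<noteq> 0\<^sub>v N" "M *\<^sub>v w = l \<cdot>\<^sub>v w"
    using assms M_carrier by (auto simp: eigenvector_def)
  define f where "f v = complex_of_real (inv_sqrt_degree G v) * w $ inv_into {..<N} vert v" for v
  show f: "f (vert i) = complex_of_real (inv_sqrt_degree G (vert i)) * w $ i" if "i < N" for i
    using that bij_vert by (simp add: f_def bij_betw_def inv_into_f_f)
  show "walk_eigenfunction l f" using w(3) norm_laplacian_eigen_iff[OF w(1) f] by simp
  have "\<exists>i<N. w $ i \<noteq> 0" using w(1,2) by (metis carrier_vecD eq_vecI index_zero_vec)
  then obtain i where i: "i < N" "w $ i \<noteq> 0" by blast
  have some: "(SOME i. i < N \<and> w $ i \<noteq> 0) < N" "w $ (SOME i. i < N \<and> w $ i \<noteq> 0) \<noteq> 0"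
    using someI[of "\<lambda>i. i < N \<and> w $ i \<noteq> 0" i] i by auto
  show "vert (SOME i. i < N \<and> w $ i \<noteq> 0) \<in> pverts G" using some(1) by (rule vert_in)
  then show "f (vert (SOME i. i < N \<and> w $ i \<noteq> 0)) \<noteq> 0"
    using f[OF some(1)] some(2) inv_sqrt_degree_pos by fastforce
qed

lemma M_hermitian: "i < N \<Longrightarrow> j < N \<Longrightarrow> M $$ (i, j) = cnj (M $$ (j, i))"
  using arcs_symmetric[of "vert i" "vert j"] arcs_symmetric[of "vert j" "vert i"]
  by (auto simp: M_index)

lemma order_simple_walk_eigenfunction:
  assumes z: "cnj z = z" and g: "walk_eigenfunction z g" "v0 \<in> pverts G" "g v0 \<noteq> 0"
    and uniq: "\<And>f. walk_eigenfunction z f \<Longrightarrow> \<exists>c. \<forall>v\<in>pverts G. f v = c * g v"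
  shows "Polynomial.order z (char_poly M) = 1"
proof (rule order_char_poly_simple_eigenvalue[OF M_carrier M_hermitian z])
  define s where "s i = complex_of_real (inv_sqrt_degree G (vert i))" for i
  have s: "s i \<noteq> 0" if "i < N" for i
    using inv_sqrt_degree_pos[OF vert_in[OF that]] by (simp add: s_def)
  define w where "w = Matrix.vec N (\<lambda>i. g (vert i) / s i)"
  have w: "w \<in> carrier_vec N" by (simp add: w_def)
  have gw: "g (vert i) = complex_of_real (inv_sqrt_degree G (vert i)) * w $ i" if "i < N" for i
    using s[OF that] that by (simp add: w_def s_def[symmetric])
  have "v0 \<in> vert ` {..<N}" using g(2) bij_vert by (simp add: bij_betw_def)
  then obtain i where i: "i < N" "vert i = v0" by auto
  have "w $ i \<noteq> 0" using g(3) i gw by force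
  then have "w \<noteq> 0\<^sub>v N" using i by auto
  then show "eigenvector M w z"
    using w norm_laplacian_eigen_iff[OF w gw] g(1) M_carrier by (auto simp: eigenvector_def)
  fix v assume v: "eigenvector M v z"
  then have vc: "v \<in> carrier_vec N" using M_carrier by (auto simp: eigenvector_def)
  obtain f where f: "\<And>i. i < N \<Longrightarrow> f (vert i) = complex_of_real (inv_sqrt_degree G (vert i)) * v $ i"
    "walk_eigenfunction z f"
    using eigenvector_imp_walk_eigenfunction[OF v] by metis
  obtain c where c: "\<And>u. u \<in> pverts G \<Longrightarrow> f u = c * g u" using uniq[OF f(2)] by blast
  have "v = c \<cdot>\<^sub>v w"
  proof (rule eq_vecI)
    fix i assume "i < dim_vec (c \<cdot>\<^sub>v w)"
    then have i: "i < N" by (simp add: w_def)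
    have "s i * v $ i = s i * (c * w $ i)"
      using f(1)[OF i] c[OF vert_in[OF i]] gw[OF i] unfolding s_def by (metis mult.left_commute)
    then have "v $ i = c * w $ i" using s[OF i] by simp
    then show "v $ i = (c \<cdot>\<^sub>v w) $ i" using i by (simp add: w_def)
  qed (use vc in \<open>simp add: w_def\<close>)
  then show "\<exists>c. v = c \<cdot>\<^sub>v w" ..
qed

text \<open>
  By connectedness only the constant functions are equal at the two ends of each arc.
\<close>

lemma order_0_norm_laplacian: "Polynomial.order 0 (char_poly M) = 1"
proof -
  obtain v0 where v0: "v0 \<in> pverts G" using has_arc by (auto dest: in_arcsD1)
  have const: "walk_eigenfunction 0 (\<lambda>_. 1)"
    by (simp add: walk_eigenfunction_def sum_neighbours_const)
  show ?thesis
  proof (rule order_simple_walk_eigenfunction[OF _ const v0])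
    fix f assume f: "walk_eigenfunction 0 f"
    have step: "f v = f u" if "(u, v) \<in> parcs G" for u v
    proof (cases "\<exists>v0\<in>pverts G. f v0 \<noteq> 0")
      case True
      then show ?thesis using walk_eigenfunction_spectrum(4)[OF f _ _ _ that] by blast
    next
      case False
      then show ?thesis using in_arcsD1[OF that] in_arcsD2[OF that] by auto
    qed
    have "f v = f v0" if "v \<in> pverts G" for v
      using v0 that by (rule connected_induct) (auto dest: step)
    then show "\<exists>c. \<forall>v\<in>pverts G. f v = c * 1" by auto
  qed auto
qed

text \<open>
  An eigenfunction for \<open>2\<close> changes its sign along each arc. In a connected graph it is determined by one
  value and takes only this value and its negative, so its level sets are a bipartition; conversely a
  bipartition yields such a function.
\<close>

lemma order_2_norm_laplacian:
  "Polynomial.order 2 (char_poly M) = (if bipartite G then 1 else 0)"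
proof (cases "bipartite G")
  case True
  then obtain X Y where XY: "pverts G = X \<union> Y" "X \<inter> Y = {}"
    "\<forall>(u, v)\<in>parcs G. u \<in> X \<and> v \<in> Y \<or> u \<in> Y \<and> v \<in> X"
    unfolding bipartite_def by blast
  obtain v0 where v0: "v0 \<in> pverts G" using has_arc by (auto dest: in_arcsD1)
  define g :: "'v \<Rightarrow> complex" where "g v = (if v \<in> X then 1 else - 1)" for v
  have gstep: "g v = - g u" if "(u, v) \<in> parcs G" for u v
    using XY(2) bspec[OF XY(3) that] by (auto simp: g_def)
  have "(\<Sum>u\<in>pverts G. if (v, u) \<in> parcs G then g u else 0)
      = (\<Sum>u\<in>pverts G. if (v, u) \<in> parcs G then - g v else 0)" for v
    by (rule sum.cong) (auto dest: gstep)
  then have g: "walk_eigenfunction 2 g"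
    by (simp add: walk_eigenfunction_def sum_neighbours_const)
  have g0: "g v \<noteq> 0" for v by (simp add: g_def)
  have "Polynomial.order 2 (char_poly M) = 1"
  proof (rule order_simple_walk_eigenfunction[OF _ g v0 g0])
    fix f assume f: "walk_eigenfunction 2 f"
    have step: "f v = - f u" if "(u, v) \<in> parcs G" for u v
    proof (cases "\<exists>v0\<in>pverts G. f v0 \<noteq> 0")
      case True
      then show ?thesis using walk_eigenfunction_spectrum(5)[OF f _ _ _ that] by blast
    next
      case False
      then show ?thesis using in_arcsD1[OF that] in_arcsD2[OF that] by auto
    qed
    have "f v = f v0 / g v0 * g v" if "v \<in> pverts G" for v
      using v0 that
    proof (rule connected_induct)
      show "f b = f v0 / g v0 * g b" if "(a, b) \<in> parcs G" "f a = f v0 / g v0 * g a" for a b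
        using that(2) by (simp add: step[OF that(1)] gstep[OF that(1)])
    qed (simp add: g0)
    then show "\<exists>c. \<forall>v\<in>pverts G. f v = c * g v" by blast
  qed auto
  then show ?thesis using True by simp
next
  case False
  have "poly (char_poly M) 2 \<noteq> 0"
  proof
    assume "poly (char_poly M) 2 = 0"
    then obtain w where w: "eigenvector M w 2"
      using eigenvalue_root_char_poly[OF M_carrier] by (auto simp: eigenvalue_def)
    obtain f v0 where f: "walk_eigenfunction 2 f" and v0: "v0 \<in> pverts G" "f v0 \<noteq> 0"
      using eigenvector_imp_walk_eigenfunction[OF w] by metis
    have step: "f v = - f u" if "(u, v) \<in> parcs G" for u v
      using walk_eigenfunction_spectrum(5)[OF f v0 _ that] by simp
    have dich: "f v = f v0 \<or> f v = - f v0" if "v \<in> pverts G" for v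
      using v0(1) that by (rule connected_induct) (auto dest: step)
    have "f v0 \<noteq> - f v0" using v0(2) by (simp add: eq_neg_iff_add_eq_0 flip: mult_2)
    then have "f u = f v0 \<longleftrightarrow> f v \<noteq> f v0" if "(u, v) \<in> parcs G" for u v
      using dich[OF in_arcsD1[OF that]] step[OF that] by force
    then have "bipartite G"
      unfolding bipartite_def
      by (intro exI[of _ "{v \<in> pverts G. f v = f v0}"] exI[of _ "{v \<in> pverts G. f v \<noteq> f v0}"])
        (auto dest: in_arcsD1 in_arcsD2)
    with False show False by simp
  qed
  then show ?thesis using False by (simp add: order_0I)
qed

lemma norm_laplacian_spectrum:
  obtains ls where "char_poly M = (\<Prod>l\<leftarrow>ls. [:- l, 1:])" "length ls = N"
    and "\<And>l. l \<in> set ls \<Longrightarrow> \<exists>r. l = complex_of_real r \<and> 0 \<le> r \<and> r \<le> 2"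
    and "count_list ls 0 = 1" and "count_list ls 2 = (if bipartite G then 1 else 0)"
proof -
  obtain ls where ls: "char_poly M = (\<Prod>l\<leftarrow>ls. [:- l, 1:])" "length ls = N"
    using char_poly_factorized[OF M_carrier] by blast
  have "\<exists>r. l = complex_of_real r \<and> 0 \<le> r \<and> r \<le> 2" if "l \<in> set ls" for l
  proof -
    have "poly (char_poly M) l = 0"
      using that by (auto simp: ls(1) poly_prod_list prod_list_zero_iff image_iff)
    then obtain w where w: "eigenvector M w l"
      using eigenvalue_root_char_poly[OF M_carrier] by (auto simp: eigenvalue_def)
    obtain f v0 where "walk_eigenfunction l f" "v0 \<in> pverts G" "f v0 \<noteq> 0"
      using eigenvector_imp_walk_eigenfunction[OF w] by metis
    from walk_eigenfunction_spectrum(1-3)[OF this] show ?thesis by blast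
  qed
  with ls show thesis
    using order_0_norm_laplacian order_2_norm_laplacian
    by (intro that[of ls]) (auto simp: order_prod_linear_factors)
qed

end

section \<open>Multiplicities in the polygon graph\<close>

lemma order_power_mult: "p \<noteq> 0 \<Longrightarrow> Polynomial.order z (p ^ m) = m * Polynomial.order z (p :: 'a::idom poly)"
  by (induction m) (simp_all add: order_mult)

lemma order_prod_list:
  fixes ps :: "'a::idom poly list"
  assumes "0 \<notin> set ps"
  shows "Polynomial.order z (prod_list ps) = (\<Sum>p\<leftarrow>ps. Polynomial.order z p)"
  using assms
proof (induction ps)
  case (Cons p ps)
  then have "p * prod_list ps \<noteq> 0" by (auto simp: prod_list_zero_iff)
  then show ?case using Cons by (simp add: order_mult)
qed simp

text \<open>
  In terms of the theorem, \<open>k\<close> is \<open>(n - 1) / 2\<close>.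
\<close>

locale odd_polygon = connected_pair_graph G + polygon G n
  for G :: "'v pair_pre_digraph" and n +
  fixes k :: nat
  assumes k: "0 < k" and n_eq: "n = Suc (2 * k)"
begin

sublocale T: finite_positive_degrees \<tau>
proof
  show "finite (pverts \<tau>)" by (simp add: pverts_polygon finite_verts finite_news)
  fix v assume "v \<in> pverts \<tau>"
  then show "0 < out_degree (with_proj \<tau>) v"
  proof (cases v)
    case (Old u)
    then show ?thesis using \<open>v \<in> pverts \<tau>\<close> degree_pos[of u]
      by (auto simp: out_degree_Old pverts_polygon news_def)
  next
    case (New e j)
    then show ?thesis using \<open>v \<in> pverts \<tau>\<close> n3 out_degree_New[of e j]
      by (auto simp: pverts_polygon news_def)
  qed
qed

abbreviation "E \<equiv> card (uedges G)"
abbreviation "A \<equiv> a_poly (int k)"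
abbreviation "B \<equiv> a_poly (int k - 1)"

lemma poly_A: "poly A z = sin_quot (Suc k) (1 - z)"
  using poly_a_poly[of "Suc k" z] by simp

lemma poly_B: "poly B z = sin_quot k (1 - z)"
  by (rule poly_a_poly)

text \<open>
  The power of \<open>(a - b) (a + b)\<close> with exponent \<open>N\<close> stands on the left since \<open>N\<close> may exceed
  \<open>E\<close>, namely by one, for trees. Elimination proves the identity wherever the auxiliary polynomial
  \<open>R\<close> of the proof does not vanish: the product in \<open>R\<close> provides the hypothesis of
  \<open>det_pencil_polygon\<close>, and its last factor is the \<open>t = a - x b\<close> by which the pencil is divided to
  bring it into the form occurring in the characteristic polynomial of \<open>G\<close>. As \<open>R\<close> is not zero, the
  two sides are equal as polynomials.
\<close>

theorem char_poly_polygon: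
  assumes ls: "char_poly M = (\<Prod>l\<leftarrow>ls. [:- l, 1:])" "length ls = N"
  obtains C where "C \<noteq> 0"
    and "char_poly T.M * ((A - B) * (A + B)) ^ N
      = Polynomial.smult C (((A - B) * (A + B)) ^ E * A ^ N * (\<Prod>l\<leftarrow>ls. level_poly k l))"
proof -
  obtain cG where cG: "cG \<noteq> 0"
    "\<And>z. poly (char_poly M) z = cG * det_on (pverts G) (pencil G (1 - z) 1)"
    using poly_char_poly_norm_laplacian by blast
  obtain cT where cT: "cT \<noteq> 0"
    "\<And>z. poly (char_poly T.M) z = cT * det_on (pverts \<tau>) (pencil \<tau> (1 - z) 1)"
    using T.poly_char_poly_norm_laplacian by blast
  define C where "C = cT * (- 2) ^ N / cG"
  define D where "D = (A - B) * (A + B)"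
  define P where "P = char_poly T.M * D ^ N"
  define Q where "Q = Polynomial.smult C (D ^ E * A ^ N * (\<Prod>l\<leftarrow>ls. level_poly k l))"
  define R where "R = (\<Prod>j\<in>{1..n}. a_poly (int j - 1)) * (A - [:1, -1:] * B)"
  have "poly ((P - Q) * R) z = 0" for z
  proof (cases "poly R z = 0")
    case False
    define x a b t s where "x = 1 - z" and "a = sin_quot (Suc k) x" and "b = sin_quot k x"
      and "t = a - x * b" and "s = x * a - b"
    define c where "c = sin_quot n x"
    have nz: "sin_quot j x \<noteq> 0" if "0 < j" "j \<le> n" for j
      using False that by (auto simp: R_def poly_prod poly_a_poly x_def)
    have "poly (A - [:1, -1:] * B) z = t"
      by (simp add: poly_A poly_B t_def x_def a_def b_def algebra_simps)
    then have t: "t \<noteq> 0" using False by (auto simp only: R_def poly_mult mult_zero_right)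
    have c: "c \<noteq> 0" "c = (a - b) * (a + b)"
      using nz[of n] n_eq sin_quot_odd[of k x]
      by (simp_all add: c_def a_def b_def algebra_simps power2_eq_square)
    have D: "poly D z = c" and A: "poly A z = a"
      by (simp_all add: D_def poly_A poly_B c(2) a_def b_def x_def)
    have scale: "t ^ length ls' * (\<Prod>l\<leftarrow>ls'. 1 - s / t - l)
        = (- 1) ^ length ls' * (\<Prod>l\<leftarrow>ls'. poly (level_poly k l) z)" for ls'
    proof (induction ls')
      case (Cons l ls')
      have "t * (1 - s / t - l) = - 1 * poly (level_poly k l) z"
        using t unfolding poly_level_poly x_def[symmetric] a_def[symmetric] b_def[symmetric]
          s_def[symmetric] t_def[symmetric]
        by (simp add: field_simps)
      moreover have "t ^ length (l # ls') * (\<Prod>l\<leftarrow>l # ls'. 1 - s / t - l)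
          = (t * (1 - s / t - l)) * (t ^ length ls' * (\<Prod>l\<leftarrow>ls'. 1 - s / t - l))"
        by (simp only: list.map prod_list.Cons length_Cons power_Suc ac_simps)
      ultimately show ?case unfolding Cons.IH by simp
    qed simp
    have "pencil G s t = (\<lambda>u v. t * pencil G (s / t) 1 u v)"
      using t by (simp add: fun_eq_iff pencil_cmult)
    then have "det_on (pverts G) (pencil G s t) = t ^ N * det_on (pverts G) (pencil G (s / t) 1)"
      by (simp add: det_on_cmult finite_verts)
    then have "cG * det_on (pverts G) (pencil G s t) = t ^ N * poly (char_poly M) (1 - s / t)"
      using cG(2)[of "1 - s / t"] by simp
    also have "\<dots> = t ^ length ls * (\<Prod>l\<leftarrow>ls. 1 - s / t - l)"
      by (simp add: ls poly_prod_list o_def)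
    also have "\<dots> = (- 1) ^ length ls * (\<Prod>l\<leftarrow>ls. poly (level_poly k l) z)" by (rule scale)
    finally have detG: "cG * det_on (pverts G) (pencil G s t)
        = (- 1) ^ N * (\<Prod>l\<leftarrow>ls. poly (level_poly k l) z)"
      unfolding ls(2) .
    have "det_on (pverts \<tau>) (pencil \<tau> x 1)
        = c ^ E * ((2 * a / c) ^ N * det_on (pverts G) (pencil G s t))"
      unfolding a_def b_def c_def s_def t_def by (rule det_pencil_polygon) (use nz n_eq in auto)
    then have "poly P z = cT * c ^ E * (2 * a) ^ N * det_on (pverts G) (pencil G s t)"
      using c(1) cT(2)[of z] by (simp add: P_def D x_def power_divide)
    also have "\<dots> = cT / cG * c ^ E * (2 * a) ^ N * (cG * det_on (pverts G) (pencil G s t))"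
      using cG(1) by simp
    also have "\<dots> = C * (c ^ E * a ^ N * (\<Prod>l\<leftarrow>ls. poly (level_poly k l) z))"
      unfolding detG C_def using cG(1) by (simp add: power_mult_distrib power_minus[of 2] field_simps)
    also have "\<dots> = poly Q z"
      by (simp add: Q_def D A poly_prod_list o_def)
    finally show ?thesis by simp
  qed simp
  then have "(P - Q) * R = 0" using poly_all_0_iff_0 by blast
  moreover have "R \<noteq> 0"
  proof
    assume "R = 0"
    then have "poly R 0 = 0" by simp
    \<comment> \<open>at \<open>z = 0\<close>, that is \<open>x = 1\<close>, the Chebyshev values are \<open>u\<^sub>j = j\<close>\<close>
    moreover have "poly R 0 = (\<Prod>j\<in>{1..n}. of_nat j) * (of_nat (Suc k) - of_nat k)"
      by (simp add: R_def poly_prod poly_a_poly poly_A poly_B sin_quot_at_1 del: sin_quot.simps)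
    ultimately show False by simp
  qed
  ultimately have "P = Q" by simp
  moreover have "C \<noteq> 0" using cG(1) cT(1) by (simp add: C_def)
  ultimately show thesis by (intro that[of C]) (simp_all add: P_def Q_def D_def)
qed

lemma order_level_poly:
  assumes "0 \<le> r" "r \<le> 2"
  shows "Polynomial.order z (level_poly k (complex_of_real r))
    = (if poly (level_poly k (complex_of_real r)) z = 0 then 1 else 0)"
  using level_poly_simple_roots(3)[OF k assms] by (auto intro: order_0I)

lemma level_poly_0_2_nonzero: "level_poly k 0 \<noteq> 0" "level_poly k 2 \<noteq> 0"
  using level_poly_simple_roots(1)[OF k, of 0] level_poly_simple_roots(1)[OF k, of 2] by simp_all

lemma AB_nonzero: "A + B \<noteq> 0" "A - B \<noteq> 0"
  using level_poly_0_2_nonzero level_poly_0[of k] level_poly_2[of k] by (metis mult_zero_right)+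

lemma poly_level_poly_0: "poly (level_poly k 0) z = 0 \<longleftrightarrow> z = 0 \<or> poly A z + poly B z = 0"
  by (simp only: level_poly_0 poly_mult poly_add) simp

lemma poly_level_poly_2: "poly (level_poly k 2) z = 0 \<longleftrightarrow> z = 2 \<or> poly A z - poly B z = 0"
  by (simp only: level_poly_2 poly_mult poly_diff) auto

text \<open>
  The simple roots of \<open>level_poly k 0 = - z (a + b)\<close> are distributed over the two factors.
\<close>

lemma order_A_plus_B:
  assumes "poly A z + poly B z = 0"
  shows "Polynomial.order z (A + B) = 1" and "z \<noteq> 0"
proof -
  have "Polynomial.order z (level_poly k 0) = 1"
    using order_level_poly[of 0 z] assms by (simp add: poly_level_poly_0)
  then have sum: "Polynomial.order z [:0, -1:] + Polynomial.order z (A + B) = 1"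
    using order_mult[of "[:0, -1:]" "A + B" z] level_poly_0_2_nonzero(1)
    unfolding level_poly_0 by simp
  have "Polynomial.order z (A + B) \<noteq> 0"
    using assms AB_nonzero(1) order_root[of "A + B" z] by simp
  with sum show "Polynomial.order z (A + B) = 1" by linarith
  with sum have "Polynomial.order z [:0, -1:] = 0" by simp
  then show "z \<noteq> 0" using order_root[of "[:0, -1:] :: complex poly" 0] by auto
qed

text \<open>
  The same argument with \<open>level_poly k 2 = (2 - z) (a - b)\<close>.
\<close>

lemma order_A_minus_B:
  assumes "poly A z - poly B z = 0"
  shows "Polynomial.order z (A - B) = 1" and "z \<noteq> 2"
proof -
  have "Polynomial.order z (level_poly k 2) = 1"
    using order_level_poly[of 2 z] assms by (simp add: poly_level_poly_2)
  then have sum: "Polynomial.order z [:2, -1:] + Polynomial.order z (A - B) = 1"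
    using order_mult[of "[:2, -1:]" "A - B" z] level_poly_0_2_nonzero(2)
    unfolding level_poly_2 by simp
  have "Polynomial.order z (A - B) \<noteq> 0"
    using assms AB_nonzero(2) order_root[of "A - B" z] by simp
  with sum show "Polynomial.order z (A - B) = 1" by linarith
  with sum have "Polynomial.order z [:2, -1:] = 0" by simp
  then show "z \<noteq> 2" using order_root[of "[:2, -1:] :: complex poly" 2] by auto
qed

lemma poly_A_nonzero:
  assumes "poly (level_poly k (complex_of_real r)) z = 0" "0 \<le> r" "r \<le> 2"
  shows "poly A z \<noteq> 0"
  using level_poly_nonzero_at_a_poly_root[OF k assms(2,3)] assms(1) by blast

text \<open>
  Where the denominator vanishes, the cleared equation fails as well: otherwise \<open>a = x b\<close> and
  \<open>b = x a\<close>, against the invariant of \<open>sin_quot\<close>.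
\<close>

lemma eq_roots_level_poly: "eq_roots (int k) l = {z. poly (level_poly k l) z = 0}"
proof -
  have "z \<in> eq_roots (int k) l \<longleftrightarrow> poly (level_poly k l) z = 0" for z
  proof -
    define x a b where "x = 1 - z" and "a = sin_quot (Suc k) x" and "b = sin_quot k x"
    obtain m where m: "k = Suc m" using k gr0_implies_Suc by blast
    have idx: "int k - 2 = int m - 1" "int k + 1 = int (Suc (Suc k)) - 1" by (simp_all add: m)
    have eval: "poly (a_poly (int k)) z = a" "poly (a_poly (int k - 1)) z = b"
      "poly (a_poly (int k - 2)) z = 2 * x * b - a" "poly (a_poly (int k + 1)) z = 2 * x * a - b"
      unfolding idx poly_a_poly poly_A a_def b_def x_def by (simp_all add: m)
    have nz: "a - x * b \<noteq> 0 \<or> x * a - b \<noteq> 0"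
    proof (rule ccontr)
      assume "\<not> ?thesis"
      then have ab: "a = x * b" "b = x * a" by simp_all
      have "a\<^sup>2 - 2 * x * a * b + b\<^sup>2 = a * (a - x * b) + b * (b - x * a)"
        by (simp add: algebra_simps power2_eq_square)
      also have "\<dots> = 0" using ab by simp
      finally show False using sin_quot_Cassini[of k x] by (simp add: a_def b_def)
    qed
    have mem: "z \<in> eq_roots (int k) l \<longleftrightarrow>
        a - x * b \<noteq> 0 \<and> 1 - (2 * (x * a - b)) / (2 * (a - x * b)) = l"
      unfolding eq_roots_def mem_Collect_eq eval by (simp add: algebra_simps)
    have lev: "poly (level_poly k l) z = (x * a - b) - (1 - l) * (a - x * b)"
      by (simp add: poly_level_poly x_def a_def b_def)
    have "(t \<noteq> 0 \<and> 1 - 2 * s / (2 * t) = l) \<longleftrightarrow> s - (1 - l) * t = 0"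
      if "t \<noteq> 0 \<or> s \<noteq> 0" for s t :: complex
    proof (cases "t = 0")
      case False
      then have "s - (1 - l) * t = 0 \<longleftrightarrow> s / t = 1 - l" by (simp add: divide_eq_eq)
      then show ?thesis using False by auto
    qed (use that in simp)
    from this[OF nz] show ?thesis unfolding mem lev .
  qed
  then show ?thesis by blast
qed

context
  fixes ls :: "complex list"
  assumes ls: "char_poly M = (\<Prod>l\<leftarrow>ls. [:- l, 1:])" "length ls = N"
    and range: "\<And>l. l \<in> set ls \<Longrightarrow> \<exists>r. l = complex_of_real r \<and> 0 \<le> r \<and> r \<le> 2"
begin

text \<open>
  The orders of the two sides of \<open>char_poly_polygon\<close>; all factors are nonzero.
\<close>

lemma order_char_poly_polygon:
  "Polynomial.order z (char_poly T.M) + N * (Polynomial.order z (A - B) + Polynomial.order z (A + B))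
    = E * (Polynomial.order z (A - B) + Polynomial.order z (A + B)) + N * Polynomial.order z A
      + (\<Sum>l\<leftarrow>ls. Polynomial.order z (level_poly k l))"
proof -
  obtain C where C: "C \<noteq> 0" "char_poly T.M * ((A - B) * (A + B)) ^ N
      = Polynomial.smult C (((A - B) * (A + B)) ^ E * A ^ N * (\<Prod>l\<leftarrow>ls. level_poly k l))"
    by (rule char_poly_polygon[OF ls])
  define D where "D = (A - B) * (A + B)"
  have D: "D \<noteq> 0" using AB_nonzero by (simp add: D_def)
  have A: "A \<noteq> 0" using poly_A_nonzero[of 0 0] by (auto simp: poly_level_poly_0)
  have chi: "char_poly T.M \<noteq> 0" using degree_monic_char_poly[OF T.M_carrier] by auto
  have lev: "0 \<notin> set (map (level_poly k) ls)"
    using range level_poly_simple_roots(1)[OF k] by fastforce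
  have oD: "Polynomial.order z D = Polynomial.order z (A - B) + Polynomial.order z (A + B)"
    unfolding D_def by (rule order_mult) (use D in \<open>simp add: D_def\<close>)
  have "Polynomial.order z (char_poly T.M * D ^ N) = Polynomial.order z (char_poly T.M) + N * Polynomial.order z D"
    using chi D by (simp add: order_mult order_power_mult)
  moreover have "Polynomial.order z (Polynomial.smult C (D ^ E * A ^ N * (\<Prod>l\<leftarrow>ls. level_poly k l)))
      = E * Polynomial.order z D + N * Polynomial.order z A
        + (\<Sum>l\<leftarrow>ls. Polynomial.order z (level_poly k l))"
    using C(1) D A lev order_prod_list[OF lev, of z]
    by (simp add: order_smult order_mult order_power_mult prod_list_zero_iff o_def)
  ultimately show ?thesis using C(2) unfolding D_def[symmetric] oD by simp
qed

text \<open>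
  The root \<open>z\<close> determines \<open>l\<close>, and it is a simple root of each factor that belongs to \<open>l\<close>.
\<close>

lemma sum_order_level_poly:
  assumes "poly (level_poly k l) z = 0"
  shows "(\<Sum>l'\<leftarrow>ls. Polynomial.order z (level_poly k l')) = count_list ls l"
proof -
  have "Polynomial.order z (level_poly k l') = (if l' = l then 1 else 0)" if l': "l' \<in> set ls" for l'
  proof -
    obtain r where "l' = complex_of_real r" "0 \<le> r" "r \<le> 2" using range[OF l'] by blast
    then have "Polynomial.order z (level_poly k l') = (if poly (level_poly k l') z = 0 then 1 else 0)"
      using order_level_poly by simp
    moreover have "poly (level_poly k l') z = 0 \<longleftrightarrow> l' = l"
      using assms level_poly_disjoint_roots by blast
    ultimately show ?thesis by simp
  qed
  then have "(\<Sum>l'\<leftarrow>ls. Polynomial.order z (level_poly k l')) = (\<Sum>l'\<leftarrow>ls. if l' = l then 1 else 0)"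
    by (intro arg_cong[of _ _ sum_list] map_cong) auto
  also have "\<dots> = count_list ls l" by (induction ls) auto
  finally show ?thesis .
qed

lemma order_polygon_generic:
  assumes "poly A z + poly B z \<noteq> 0" "poly A z - poly B z \<noteq> 0"
  shows "Polynomial.order z (char_poly T.M)
    = N * Polynomial.order z A + (\<Sum>l\<leftarrow>ls. Polynomial.order z (level_poly k l))"
proof -
  have "Polynomial.order z (A + B) = 0" "Polynomial.order z (A - B) = 0"
    using assms by (auto intro!: order_0I)
  then show ?thesis using order_char_poly_polygon[of z] by simp
qed

lemma order_polygon_level:
  assumes l: "l = complex_of_real r" "0 \<le> r" "r \<le> 2" and root: "poly (level_poly k l) z = 0"
    and "poly A z + poly B z \<noteq> 0" "poly A z - poly B z \<noteq> 0"
  shows "Polynomial.order z (char_poly T.M) = count_list ls l"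
proof -
  have "Polynomial.order z A = 0" using poly_A_nonzero[of r z] l root by (auto intro!: order_0I)
  then show ?thesis using order_polygon_generic assms(5,6) sum_order_level_poly[OF root] by simp
qed

lemma order_polygon_0: "Polynomial.order 0 (char_poly T.M) = count_list ls 0"
proof (rule order_polygon_level[of 0 0])
  show "poly A 0 + poly B 0 \<noteq> 0" using order_A_plus_B(2) by blast
  show root: "poly (level_poly k 0) 0 = 0" by (simp add: poly_level_poly_0)
  show "poly A 0 - poly B 0 \<noteq> 0"
    using level_poly_disjoint_roots[OF root, of 2] by (auto simp: poly_level_poly_2)
qed auto

lemma order_polygon_2: "Polynomial.order 2 (char_poly T.M) = count_list ls 2"
proof (rule order_polygon_level[of 2 2])
  show "poly A 2 - poly B 2 \<noteq> 0" using order_A_minus_B(2) by blast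
  show root: "poly (level_poly k 2) 2 = 0" by (simp add: poly_level_poly_2)
  show "poly A 2 + poly B 2 \<noteq> 0"
    using level_poly_disjoint_roots[OF root, of 0] by (auto simp: poly_level_poly_0)
qed auto

lemma order_polygon_A_root:
  assumes "poly A z = 0"
  shows "Polynomial.order z (char_poly T.M) = N"
proof -
  have nz: "poly (level_poly k (complex_of_real r)) z \<noteq> 0" if "0 \<le> r" "r \<le> 2" for r
    using poly_A_nonzero[OF _ that] assms by blast
  have "(\<Sum>l\<leftarrow>ls. Polynomial.order z (level_poly k l)) = (\<Sum>l\<leftarrow>ls. 0)"
    using range nz by (intro arg_cong[of _ _ sum_list] map_cong) (auto intro!: order_0I)
  moreover have "poly A z + poly B z \<noteq> 0" "poly A z - poly B z \<noteq> 0"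
    using nz[of 0] nz[of 2] poly_level_poly_0[of z] poly_level_poly_2[of z] by auto
  ultimately show ?thesis
    using order_polygon_generic order_a_poly[OF k assms] by simp
qed

text \<open>
  The root lies in the factors \<open>(a + b)\<^sup>E\<close> and \<open>(a + b)\<^sup>N\<close> of the two sides and in the factors
  \<open>level_poly k 0\<close>, of which there are as many as the multiplicity of \<open>0\<close> in the spectrum of \<open>G\<close>.
\<close>

lemma order_polygon_plus_root:
  assumes "poly A z + poly B z = 0"
  shows "Polynomial.order z (char_poly T.M) + N = E + count_list ls 0"
proof -
  have root: "poly (level_poly k 0) z = 0" using assms by (simp add: poly_level_poly_0)
  have "poly A z \<noteq> 0" using poly_A_nonzero[of 0 z] root by simp
  moreover have "poly A z - poly B z \<noteq> 0"
    using level_poly_disjoint_roots[OF root, of 2] by (auto simp: poly_level_poly_2)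
  ultimately have "Polynomial.order z A = 0" "Polynomial.order z (A - B) = 0"
    by (auto intro!: order_0I)
  then show ?thesis
    using order_char_poly_polygon[of z] order_A_plus_B(1)[OF assms] sum_order_level_poly[OF root]
    by simp
qed

lemma order_polygon_minus_root:
  assumes "poly A z - poly B z = 0"
  shows "Polynomial.order z (char_poly T.M) + N = E + count_list ls 2"
proof -
  have root: "poly (level_poly k 2) z = 0" using assms by (simp add: poly_level_poly_2)
  have "poly A z \<noteq> 0" using poly_A_nonzero[of 2 z] root by simp
  moreover have "poly A z + poly B z \<noteq> 0"
    using level_poly_disjoint_roots[OF root, of 0] by (auto simp: poly_level_poly_0)
  ultimately have "Polynomial.order z A = 0" "Polynomial.order z (A + B) = 0"
    by (auto intro!: order_0I)
  then show ?thesis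
    using order_char_poly_polygon[of z] order_A_minus_B(1)[OF assms] sum_order_level_poly[OF root]
    by simp
qed

lemma order_polygon_lifted:
  assumes l: "l \<in> set ls" "l \<noteq> 0" "l \<noteq> 2" and root: "poly (level_poly k l) z = 0"
  shows "Polynomial.order z (char_poly T.M) = count_list ls l"
proof -
  obtain r where r: "l = complex_of_real r" "0 \<le> r" "r \<le> 2" using range[OF l(1)] by blast
  show ?thesis
  proof (rule order_polygon_level[OF r root])
    show "poly A z + poly B z \<noteq> 0"
      using level_poly_disjoint_roots[OF root, of 0] l by (auto simp: poly_level_poly_0)
    show "poly A z - poly B z \<noteq> 0"
      using level_poly_disjoint_roots[OF root, of 2] l by (auto simp: poly_level_poly_2)
  qed
qed

lemma order_polygon_pos_cases:
  assumes "Polynomial.order z (char_poly T.M) \<noteq> 0"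
  shows "poly A z = 0 \<or> poly A z + poly B z = 0 \<or> poly A z - poly B z = 0 \<or>
    (\<exists>l\<in>set ls. poly (level_poly k l) z = 0)"
proof (rule ccontr)
  assume *: "\<not> ?thesis"
  then have "Polynomial.order z A = 0" by (auto intro!: order_0I)
  moreover have "(\<Sum>l\<leftarrow>ls. Polynomial.order z (level_poly k l)) = (\<Sum>l\<leftarrow>ls. 0)"
    using * by (intro arg_cong[of _ _ sum_list] map_cong) (auto intro!: order_0I)
  ultimately show False using order_polygon_generic[of z] * assms by simp
qed

end

end

theorem theorem4p2:
  fixes G :: "'a pair_pre_digraph" and n N0 E0 :: nat and k :: int
    and L Lt :: "real mat"
  assumes "pair_graph G" and "Digraph_Component.connected (with_proj G)" and "parcs G \<noteq> {}"
    and N0: "N0 = card (pverts G)" and E0: "E0 = card (uedges G)"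
    and "n \<ge> 3" and "odd n" and k: "k = (int n - 1) div 2"
    and L: "L = norm_laplacian G" and Lt: "Lt = norm_laplacian (polygon_graph n G)"
  shows
    "(eig_mult Lt 0 = 1 \<and> (bipartite G \<longrightarrow> eig_mult Lt 2 = 1)) \<and>
     (\<forall>\<mu>. poly (a_poly k) \<mu> = 0 \<longrightarrow> eig_mult Lt \<mu> = N0) \<and>
     (\<forall>\<mu>. poly (a_poly k) \<mu> + poly (a_poly (k - 1)) \<mu> = 0 \<longrightarrow>
        int (eig_mult Lt \<mu>) = int E0 - int N0 + 1) \<and>
     (\<not> bipartite G \<longrightarrow> (\<forall>\<mu>. poly (a_poly k) \<mu> - poly (a_poly (k - 1)) \<mu> = 0 \<longrightarrow>
        int (eig_mult Lt \<mu>) = int E0 - int N0)) \<and>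
     (bipartite G \<longrightarrow> (\<forall>\<mu>. poly (a_poly k) \<mu> - poly (a_poly (k - 1)) \<mu> = 0 \<longrightarrow>
        int (eig_mult Lt \<mu>) = int E0 - int N0 + 1)) \<and>
     (\<forall>l. is_eigenvalue L l \<and> l \<noteq> 0 \<and> l \<noteq> 2 \<longrightarrow>
        card (eq_roots k l) = (n + 1) div 2 \<and>
        (\<forall>\<mu> \<in> eq_roots k l. is_eigenvalue Lt \<mu> \<and> eig_mult L l = eig_mult Lt \<mu>)) \<and>
     (\<forall>\<mu>. is_eigenvalue Lt \<mu> \<longrightarrow>
        \<mu> = 0 \<or> (bipartite G \<and> \<mu> = 2) \<or>
        poly (a_poly k) \<mu> = 0 \<or>
        poly (a_poly k) \<mu> + poly (a_poly (k - 1)) \<mu> = 0 \<or>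
        poly (a_poly k) \<mu> - poly (a_poly (k - 1)) \<mu> = 0 \<or>
        (\<exists>l. is_eigenvalue L l \<and> l \<noteq> 0 \<and> l \<noteq> 2 \<and> \<mu> \<in> eq_roots k l))"
proof -
  obtain h where h: "n = Suc (2 * h)" using \<open>odd n\<close> by (elim oddE) simp
  have kh: "k = int h" by (simp add: k h)
  interpret pair_graph G by fact
  interpret odd_polygon G n h
    by unfold_locales (use assms h in auto)
  obtain ls where ls: "char_poly M = (\<Prod>l\<leftarrow>ls. [:- l, 1:])" "length ls = N"
    and range: "\<And>l. l \<in> set ls \<Longrightarrow> \<exists>r. l = complex_of_real r \<and> 0 \<le> r \<and> r \<le> 2"
    and count: "count_list ls 0 = 1" "count_list ls 2 = (if bipartite G then 1 else 0)"
    using norm_laplacian_spectrum by blast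
  note facts = ls range
  have multL: "eig_mult L l = count_list ls l" for l
    by (simp add: eig_mult_def L ls(1) order_prod_linear_factors)
  have multLt: "eig_mult Lt z = Polynomial.order z (char_poly T.M)" for z
    by (simp add: eig_mult_def Lt)
  have evL: "is_eigenvalue L l \<longleftrightarrow> l \<in> set ls" for l
    unfolding is_eigenvalue_def L eigenvalue_root_char_poly[OF M_carrier] ls(1)
    by (auto simp: poly_prod_list prod_list_zero_iff)
  have evLt: "is_eigenvalue Lt z \<longleftrightarrow> Polynomial.order z (char_poly T.M) \<noteq> 0" for z
  proof -
    have "char_poly T.M \<noteq> 0" using degree_monic_char_poly[OF T.M_carrier] by auto
    then show ?thesis
      unfolding is_eigenvalue_def Lt eigenvalue_root_char_poly[OF T.M_carrier]
      by (simp add: order_root)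
  qed
  have lifted: "card (eq_roots k l) = (n + 1) div 2 \<and>
      (\<forall>\<mu>\<in>eq_roots k l. is_eigenvalue Lt \<mu> \<and> eig_mult L l = eig_mult Lt \<mu>)"
    if l: "is_eigenvalue L l" "l \<noteq> 0" "l \<noteq> 2" for l
  proof -
    have lls: "l \<in> set ls" using l(1) by (simp add: evL)
    obtain r where r: "l = complex_of_real r" "0 \<le> r" "r \<le> 2" using range[OF lls] by blast
    have "card (eq_roots k l) = Suc h"
      unfolding kh eq_roots_level_poly r(1) by (rule level_poly_simple_roots(2)[OF odd_polygon.k r(2,3)]) unfold_locales
    moreover have "Polynomial.order z (char_poly T.M) = count_list ls l" if "z \<in> eq_roots k l" for z
      using that order_polygon_lifted[OF facts lls l(2,3)] by (simp add: kh eq_roots_level_poly)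
    moreover have "count_list ls l \<noteq> 0" using lls by (simp add: count_list_0_iff)
    ultimately show ?thesis by (simp add: multL multLt evLt h)
  qed
  have complete: "\<mu> = 0 \<or> (bipartite G \<and> \<mu> = 2) \<or> poly (a_poly k) \<mu> = 0 \<or>
      poly (a_poly k) \<mu> + poly (a_poly (k - 1)) \<mu> = 0 \<or>
      poly (a_poly k) \<mu> - poly (a_poly (k - 1)) \<mu> = 0 \<or>
      (\<exists>l. is_eigenvalue L l \<and> l \<noteq> 0 \<and> l \<noteq> 2 \<and> \<mu> \<in> eq_roots k l)"
    if "is_eigenvalue Lt \<mu>" for \<mu>
  proof -
    have "2 \<in> set ls \<Longrightarrow> bipartite G" using count(2) by (auto simp: count_list_0_iff split: if_splits)
    then show ?thesis
      using order_polygon_pos_cases[OF facts, of \<mu>] that poly_level_poly_0[of \<mu>] poly_level_poly_2[of \<mu>]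
      unfolding evLt evL kh eq_roots_level_poly mem_Collect_eq by metis
  qed
  have plus: "int (eig_mult Lt \<mu>) = int E0 - int N0 + 1"
    if "poly (a_poly k) \<mu> + poly (a_poly (k - 1)) \<mu> = 0" for \<mu>
  proof -
    have "eig_mult Lt \<mu> + N0 = E0 + 1"
      using order_polygon_plus_root[OF facts, of \<mu>] that
      by (simp only: multLt kh N0 E0 count(1))
    then show ?thesis by linarith
  qed
  have minus: "int (eig_mult Lt \<mu>) = int E0 - int N0 + (if bipartite G then 1 else 0)"
    if "poly (a_poly k) \<mu> - poly (a_poly (k - 1)) \<mu> = 0" for \<mu>
  proof -
    have "eig_mult Lt \<mu> + N0 = E0 + (if bipartite G then 1 else 0)"
      using order_polygon_minus_root[OF facts, of \<mu>] that
      by (simp only: multLt kh N0 E0 count(2))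
    then show ?thesis by (cases "bipartite G") simp_all
  qed
  have A_root: "eig_mult Lt \<mu> = N0" if "poly (a_poly k) \<mu> = 0" for \<mu>
    using order_polygon_A_root[OF facts, of \<mu>] that by (simp only: multLt kh N0)
  have "eig_mult Lt 0 = 1" "bipartite G \<Longrightarrow> eig_mult Lt 2 = 1"
    using order_polygon_0[OF facts] order_polygon_2[OF facts] by (simp_all add: multLt count)
  moreover have "\<forall>l. is_eigenvalue L l \<and> l \<noteq> 0 \<and> l \<noteq> 2 \<longrightarrow> card (eq_roots k l) = (n + 1) div 2 \<and>
      (\<forall>\<mu>\<in>eq_roots k l. is_eigenvalue Lt \<mu> \<and> eig_mult L l = eig_mult Lt \<mu>)"
    using lifted by blast
  ultimately show ?thesis
    using A_root plus minus complete by (intro conjI) simp_all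
qed

end
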